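(* Let $n\in\mathbb{N}$, $n\ge2$, and $a\in C^\infty_c(\mathbb{R}^n,\mathbb{R}^n)$. Then $a=a_{\operatorname{div}}+a_{\operatorname{curl}_n}$, where $a_{\operatorname{div}}$ is divergence-free (that is, $\operatorname{div}a_{\operatorname{div}}=0$), $a_{\operatorname{curl}_n}$ is a gradient field and hence $\operatorname{curl}_n$-free (that is, $\operatorname{curl}_n a_{\operatorname{curl}_n}=0$), and these parts are given explicitly for $x\in\mathbb{R}^n$ by $$a_{\operatorname{curl}_n}(x)=\nabla_x\int_{\mathbb{R}^n}G^{(n)}(x,y)\,\operatorname{div}a(y)\,\mathrm{d}y=\frac{1}{n\omega_n}\int_{\mathbb{R}^n}\|x-y\|^{-n}\operatorname{div}a(y)\,(x-y)\,\mathrm{d}y$$ and $$a_{\operatorname{div}}(x)=M_n(\nabla_x)^T\int_{\mathbb{R}^n}G^{(n)}(x,y)\,\operatorname{curl}_n a(y)\,\mathrm{d}y=\frac{1}{n\omega_n}\int_{\mathbb{R}^n}M_n(x-y)^T\big(\|x-y\|^{-n}\operatorname{curl}_n a(y)\big)\,\mathrm{d}y .$$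
   Context: The generalized cross product $\times_n:\mathbb{R}^n\times\mathbb{R}^n\to\mathbb{R}^{n(n-1)/2}$ is the bilinear map for which $a\times_n b$ has entries $\alpha_i\beta_j-\alpha_j\beta_i$ for $1\le i<j\le n$, listed in the order $(i,j)=(1,2),(1,3),(2,3),(1,4),(2,4),(3,4),\ldots$, where $a=(\alpha_i)$ and $b=(\beta_i)$. For $b\in\mathbb{R}^n$, $M_n(b)\in\mathbb{R}^{\frac{n(n-1)}{2}\times n}$ is the unique matrix with $M_n(b)\,x=b\times_n x$ for all $x\in\mathbb{R}^n$; its entries are linear in $b$. Replacing $b$ by the vector differential operator $\nabla=(\partial_1,\ldots,\partial_n)^T$ defines first-order differential operators as follows. For a vector field $a=(a_1,\ldots,a_n)^T$, $\operatorname{curl}_n a=M_n(\nabla)a=\nabla\times_n a$. This is the $\mathbb{R}^{n(n-1)/2}$-valued field with entries $\partial_i a_j-\partial_j a_i$, $i<j$, listed in the order $(i,j)=(1,2),(1,3),(2,3),(1,4),(2,4),(3,4),\ldots$. For a field $\mathfrak{a}=(\mathfrak{a}_{ij})_{i<j}$ with values in $\mathbb{R}^{n(n-1)/2}$ (indexed in the order $(i,j)=(1,2),(1,3),(2,3),(1,4),(2,4),(3,4),\ldots$), $M_n(\nabla)^T\mathfrak{a}$ is the $\mathbb{R}^n$-valued field with $k$-th component $\sum_{i<k}\partial_i\mathfrak{a}_{ik}-\sum_{j>k}\partial_j\mathfrak{a}_{kj}$. The subscript $x$ in $\nabla_x$ indicates differentiation with respect to $x$. $\|\cdot\|$ is the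 Euclidean norm, $\omega_n$ is the volume of the unit ball in $\mathbb{R}^n$, and $G^{(n)}$ is the fundamental solution of the Laplacian on $\mathbb{R}^n$: $G^{(2)}(x,y)=\frac{1}{2\pi}\ln\|x-y\|$, and $G^{(n)}(x,y)=\frac{1}{n(2-n)\omega_n}\|x-y\|^{2-n}$ for $n\ge3$. *)

theory Defs
  imports "HOL-Analysis.Analysis"
begin

text \<open>
  Conventions. The space of real \<open>n\<close>-vectors is \<open>real^'n\<close> with a linearly ordered finite index type
  \<open>'n\<close>, \<open>CARD('n) = n\<close>. The space of real \<open>n(n-1)/2\<close>-vectors is \<open>real^'m\<close>, again with a linearly
  ordered finite index type, subject to \<open>CARD('m) = n(n-1)/2\<close>; its coordinates are matched
  with the pairs \<open>i < j\<close> according to the listing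
  \<open>(1,2), (1,3), (2,3), (1,4), (2,4), (3,4), \<dots>\<close>, that is, the colexicographic order.
\<close>


subsection \<open>Smooth maps with compact support\<close>

primrec C_k :: "nat \<Rightarrow> ('a::euclidean_space \<Rightarrow> 'b::real_normed_vector) \<Rightarrow> bool" where
  "C_k 0 f \<longleftrightarrow> continuous_on UNIV f"
| "C_k (Suc k) f \<longleftrightarrow>
     (\<forall>x. f differentiable (at x)) \<and> (\<forall>v. C_k k (\<lambda>x. frechet_derivative f (at x) v))"

definition C_infinity :: "('a::euclidean_space \<Rightarrow> 'b::real_normed_vector) \<Rightarrow> bool" where
  "C_infinity f \<longleftrightarrow> (\<forall>k. C_k k f)"

definition compactly_supported :: "('a::topological_space \<Rightarrow> 'b::zero) \<Rightarrow> bool" where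
  "compactly_supported f \<longleftrightarrow> compact (closure {x. f x \<noteq> 0})"


subsection \<open>The listing of the pairs \<open>i < j\<close>\<close>

definition index_pairs :: "('n::linorder \<times> 'n) set" where
  "index_pairs = {(i, j). i < j}"

definition colex_less :: "'n::linorder \<times> 'n \<Rightarrow> 'n \<times> 'n \<Rightarrow> bool" where
  "colex_less p q \<longleftrightarrow> snd p < snd q \<or> snd p = snd q \<and> fst p < fst q"

text \<open>
  \<open>pair_pos i j\<close> is the coordinate that has as many predecessors as \<open>(i, j)\<close> has in the listing,
  and \<open>pair_at k\<close> is the pair at coordinate \<open>k\<close>. Both are meaningful for
  \<open>CARD('m) = CARD('n) * (CARD('n) - 1) div 2\<close> and \<open>i < j\<close> only, see \<open>bij_betw_pair_pos\<close> and
  \<open>pair_pos_less_iff\<close> below.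
\<close>

definition pair_pos :: "'n::{finite,linorder} \<Rightarrow> 'n \<Rightarrow> 'm::{finite,linorder}" where
  "pair_pos i j = (THE k. card {l. l < k} = card {p \<in> index_pairs. colex_less p (i, j)})"

definition pair_at :: "'m::{finite,linorder} \<Rightarrow> 'n::{finite,linorder} \<times> 'n" where
  "pair_at k = (THE p. p \<in> index_pairs \<and> pair_pos (fst p) (snd p) = k)"


subsection \<open>The generalized cross product\<close>

definition gen_cross ::
    "real^'n::{finite,linorder} \<Rightarrow> real^'n::{finite,linorder} \<Rightarrow> real^'m::{finite,linorder}" where
  "gen_cross a b = (\<chi> k. case pair_at k of (i, j) \<Rightarrow> a $ i * b $ j - a $ j * b $ i)"

definition cross_matrix ::
    "real^'n::{finite,linorder} \<Rightarrow> real^'n::{finite,linorder}^'m::{finite,linorder}" where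
  "cross_matrix b = (THE M. \<forall>x. M *v x = gen_cross b x)"


subsection \<open>Differential operators\<close>

text \<open>
  \<open>frechet_derivative\<close> is unspecified at points of non-differentiability, so a statement about the
  following operators is informative only together with differentiability of the field.
\<close>

definition partial :: "'n::finite \<Rightarrow> (real^'n \<Rightarrow> 'b::real_normed_vector) \<Rightarrow> real^'n \<Rightarrow> 'b" where
  "partial i f x = frechet_derivative f (at x) (axis i 1)"

definition divergence :: "(real^'n \<Rightarrow> real^'n) \<Rightarrow> real^'n \<Rightarrow> real" where
  "divergence a x = (\<Sum>i\<in>UNIV. partial i (\<lambda>z. a z $ i) x)"

definition gen_curl ::
    "(real^'n::{finite,linorder} \<Rightarrow> real^'n::{finite,linorder}) \<Rightarrow>
     real^'n::{finite,linorder} \<Rightarrow> real^'m::{finite,linorder}" where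
  "gen_curl a x =
     (\<chi> k. case pair_at k of (i, j) \<Rightarrow>
        partial i (\<lambda>z. a z $ j) x - partial j (\<lambda>z. a z $ i) x)"

text \<open>The operator obtained from \<open>transpose (cross_matrix b)\<close> by substituting the gradient
  symbol for \<open>b\<close>.\<close>

definition cross_matrix_nabla_transpose ::
    "(real^'n::{finite,linorder} \<Rightarrow> real^'m::{finite,linorder}) \<Rightarrow>
     real^'n::{finite,linorder} \<Rightarrow> real^'n::{finite,linorder}" where
  "cross_matrix_nabla_transpose c x =
     (\<chi> k. (\<Sum>i | i < k. partial i (\<lambda>z. c z $ pair_pos i k) x)
          - (\<Sum>j | k < j. partial j (\<lambda>z. c z $ pair_pos k j) x))"

definition gradient_field :: "(real^'n \<Rightarrow> real^'n) \<Rightarrow> bool" where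
  "gradient_field a \<longleftrightarrow> (\<exists>\<phi>. \<forall>x. GDERIV \<phi> x :> a x)"


subsection \<open>The fundamental solution of the Laplacian\<close>

definition unit_ball_volume :: "'n::finite itself \<Rightarrow> real" where
  "unit_ball_volume _ = measure lborel (ball (0 :: real^'n) 1)"

text \<open>Intended for dimension at least 2. On the diagonal, where the kernel is singular, the library
  conventions \<open>ln 0 = 0\<close> and \<open>inverse 0 = 0\<close> give the value 0; the diagonal is a null set.\<close>

definition fundamental_solution :: "real^'n \<Rightarrow> real^'n \<Rightarrow> real" where
  "fundamental_solution x y =
     (if CARD('n) = 2 then 1 / (2 * pi) * ln (norm (x - y))
      else 1 / (real CARD('n) * (2 - real CARD('n)) * unit_ball_volume TYPE('n))
             * norm (x - y) powi (2 - int CARD('n)))"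


subsection \<open>Consistency of the conventions\<close>

lemma card_index_pairs:
  "card (index_pairs :: ('n::{finite,linorder} \<times> 'n) set) = CARD('n) * (CARD('n) - 1) div 2"
proof -
  let ?P = "index_pairs :: ('n \<times> 'n) set"
  let ?D = "range (\<lambda>i::'n. (i, i))"
  have U: "UNIV = ?D \<union> (?P \<union> prod.swap ` ?P)"
    by (auto simp: index_pairs_def image_iff not_less order.order_iff_strict)
  have "CARD('n \<times> 'n) = card ?D + card (?P \<union> prod.swap ` ?P)"
    by (subst U, rule card_Un_disjoint) (auto simp: index_pairs_def)
  also have "card (?P \<union> prod.swap ` ?P) = card ?P + card (prod.swap ` ?P)"
    by (rule card_Un_disjoint) (auto simp: index_pairs_def)
  also have "card (prod.swap ` ?P) = card ?P"
    by (rule card_image) (auto simp: inj_on_def)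
  also have "card ?D = CARD('n)"
    by (rule card_image) (auto simp: inj_on_def)
  finally have "CARD('n) * CARD('n) = CARD('n) + 2 * card ?P"
    by simp
  then have "CARD('n) * (CARD('n) - 1) = 2 * card ?P"
    by (simp add: right_diff_distrib')
  then show ?thesis by simp
qed

lemma strict_mono_card_less:
  "strict_mono (\<lambda>k::'m::{finite,linorder}. card {l. l < k})"
  by (rule strict_monoI) (auto intro!: psubset_card_mono)

lemma card_less_less: "card {l. l < (k::'m::{finite,linorder})} < CARD('m)"
  by (rule psubset_card_mono) auto

lemma bij_betw_card_less:
  "bij_betw (\<lambda>k::'m::{finite,linorder}. card {l. l < k}) UNIV {..<CARD('m)}"
proof -
  have inj: "inj (\<lambda>k::'m. card {l. l < k})"
    using strict_mono_card_less by (rule strict_mono_imp_inj_on)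
  have "range (\<lambda>k::'m. card {l. l < k}) = {..<CARD('m)}"
  proof (rule card_subset_eq)
    show "range (\<lambda>k::'m. card {l. l < k}) \<subseteq> {..<CARD('m)}"
      using card_less_less by blast
    show "card (range (\<lambda>k::'m. card {l. l < k})) = card {..<CARD('m)}"
      using card_image[OF inj] by simp
  qed simp
  with inj show ?thesis by (simp add: bij_betw_def)
qed

lemma colex_rank_mono:
  fixes p q :: "'n::{finite,linorder} \<times> 'n"
  assumes "p \<in> index_pairs" "colex_less p q"
  shows "card {r \<in> index_pairs. colex_less r p} < card {r \<in> index_pairs. colex_less r q}"
proof (rule psubset_card_mono)
  show "{r \<in> index_pairs. colex_less r p} \<subset> {r \<in> index_pairs. colex_less r q}"
  proof
    show "{r \<in> index_pairs. colex_less r p} \<subseteq> {r \<in> index_pairs. colex_less r q}"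
      using assms(2) by (auto simp: colex_less_def)
    have "p \<in> {r \<in> index_pairs. colex_less r q}" "p \<notin> {r \<in> index_pairs. colex_less r p}"
      using assms by (auto simp: colex_less_def)
    then show "{r \<in> index_pairs. colex_less r p} \<noteq> {r \<in> index_pairs. colex_less r q}"
      by blast
  qed
qed simp

lemma colex_rank_less:
  fixes p :: "'n::{finite,linorder} \<times> 'n"
  assumes "p \<in> index_pairs"
  shows "card {r \<in> index_pairs. colex_less r p} < CARD('n) * (CARD('n) - 1) div 2"
proof -
  have "{r \<in> index_pairs. colex_less r p} \<subset> (index_pairs :: ('n \<times> 'n) set)"
    using assms by (auto simp: colex_less_def)
  then show ?thesis
    by (subst card_index_pairs[symmetric]) (rule psubset_card_mono, simp_all)
qed

lemma card_less_pair_pos: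
  fixes i j :: "'n::{finite,linorder}"
  assumes "CARD('m::{finite,linorder}) = CARD('n) * (CARD('n) - 1) div 2" and "i < j"
  shows "card {l. l < (pair_pos i j :: 'm)} = card {p \<in> index_pairs. colex_less p (i, j)}"
proof -
  have "(i, j) \<in> index_pairs"
    using assms(2) by (simp add: index_pairs_def)
  then have "card {p \<in> index_pairs. colex_less p (i, j)} \<in> {..<CARD('m)}"
    using colex_rank_less[of "(i, j)"] assms(1) by simp
  then have "card {p \<in> index_pairs. colex_less p (i, j)} \<in> range (\<lambda>k::'m. card {l. l < k})"
    by (simp only: bij_betw_imp_surj_on[OF bij_betw_card_less[where 'm = 'm]])
  then have "\<exists>!k::'m. card {l. l < k} = card {p \<in> index_pairs. colex_less p (i, j)}"
    using injD[OF bij_betw_imp_inj_on[OF bij_betw_card_less[where 'm = 'm]]] by (auto simp: image_iff)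
  then show ?thesis
    unfolding pair_pos_def by (rule theI')
qed

lemma pair_pos_less_iff:
  fixes i j i' j' :: "'n::{finite,linorder}"
  assumes "CARD('m::{finite,linorder}) = CARD('n) * (CARD('n) - 1) div 2" and "i < j" "i' < j'"
  shows "(pair_pos i j :: 'm) < pair_pos i' j' \<longleftrightarrow> j < j' \<or> j = j' \<and> i < i'"
proof -
  have "(pair_pos i j :: 'm) < pair_pos i' j' \<longleftrightarrow>
      card {p \<in> index_pairs. colex_less p (i, j)} < card {p \<in> index_pairs. colex_less p (i', j')}"
    by (subst strict_mono_less[OF strict_mono_card_less, symmetric])
      (simp add: card_less_pair_pos assms)
  also have "\<dots> \<longleftrightarrow> colex_less (i, j) (i', j')"
  proof -
    have "(i, j) \<in> index_pairs" "(i', j') \<in> index_pairs"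
      using assms by (auto simp: index_pairs_def)
    moreover have "colex_less (i, j) (i', j') \<or> (i, j) = (i', j') \<or> colex_less (i', j') (i, j)"
      by (auto simp: colex_less_def)
    ultimately show ?thesis
      using colex_rank_mono[of "(i, j)" "(i', j')"] colex_rank_mono[of "(i', j')" "(i, j)"]
      by auto
  qed
  finally show ?thesis by (simp add: colex_less_def)
qed

lemma bij_betw_pair_pos:
  assumes "CARD('m::{finite,linorder}) = CARD('n::{finite,linorder}) * (CARD('n) - 1) div 2"
  shows "bij_betw (\<lambda>p. pair_pos (fst p) (snd p) :: 'm) (index_pairs :: ('n \<times> 'n) set) UNIV"
proof -
  have "inj_on (\<lambda>p. pair_pos (fst p) (snd p) :: 'm) (index_pairs :: ('n \<times> 'n) set)"
  proof (rule inj_onI, clarify)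
    fix i j i' j' :: 'n
    assume "(i, j) \<in> index_pairs" "(i', j') \<in> index_pairs"
      and eq: "(pair_pos (fst (i, j)) (snd (i, j)) :: 'm) = pair_pos (fst (i', j')) (snd (i', j'))"
    then have "i < j" "i' < j'" by (auto simp: index_pairs_def)
    from eq have "\<not> (pair_pos i j :: 'm) < pair_pos i' j'" "\<not> (pair_pos i' j' :: 'm) < pair_pos i j"
      by simp_all
    then show "i = i' \<and> j = j'"
      unfolding pair_pos_less_iff[OF assms \<open>i < j\<close> \<open>i' < j'\<close>]
        pair_pos_less_iff[OF assms \<open>i' < j'\<close> \<open>i < j\<close>] by auto
  qed
  then show ?thesis
    unfolding bij_betw_def
    by (intro conjI card_subset_eq) (simp_all add: card_image card_index_pairs assms)
qed

lemma
  assumes "CARD('m::{finite,linorder}) = CARD('n::{finite,linorder}) * (CARD('n) - 1) div 2"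
  shows pair_at_pair_pos: "i < j \<Longrightarrow> pair_at (pair_pos i j :: 'm) = (i, j :: 'n)"
    and pair_at_less: "pair_at (k :: 'm) = (i, j :: 'n) \<Longrightarrow> i < j"
    and pair_pos_pair_at: "pair_at (k :: 'm) = (i, j :: 'n) \<Longrightarrow> pair_pos i j = k"
proof -
  let ?f = "\<lambda>p :: 'n \<times> 'n. pair_pos (fst p) (snd p) :: 'm"
  have inj: "p = q" if "p \<in> index_pairs" "q \<in> index_pairs" "?f p = ?f q" for p q
    using inj_onD[OF bij_betw_imp_inj_on[OF bij_betw_pair_pos[OF assms]]] that by blast
  have ex: "\<exists>!p. p \<in> index_pairs \<and> ?f p = k" for k
  proof -
    have "k \<in> ?f ` index_pairs"
      using bij_betw_imp_surj_on[OF bij_betw_pair_pos[OF assms]] by simp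
    then show ?thesis using inj by blast
  qed
  have at: "(pair_at k :: 'n \<times> 'n) \<in> index_pairs \<and> ?f (pair_at k) = k" for k
    unfolding pair_at_def by (rule theI'[OF ex])
  show "pair_at (k :: 'm) = (i, j :: 'n) \<Longrightarrow> i < j" for k i j
    using at[of k] by (simp add: index_pairs_def)
  show "pair_at (k :: 'm) = (i, j :: 'n) \<Longrightarrow> pair_pos i j = k" for k i j
    using at[of k] by simp
  show "i < j \<Longrightarrow> pair_at (pair_pos i j :: 'm) = (i, j :: 'n)" for i j
    by (rule inj) (use at in \<open>simp_all add: index_pairs_def\<close>)
qed

lemma linear_gen_cross: "linear (gen_cross b)"
  by (rule linearI)
    (auto simp: gen_cross_def vec_eq_iff algebra_simps split: prod.split)

lemma cross_matrix_eq: "cross_matrix b = matrix (gen_cross b)"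
  unfolding cross_matrix_def
proof (rule the_equality)
  show "\<forall>x. matrix (gen_cross b) *v x = gen_cross b x"
    by (simp add: fun_cong[OF matrix_vector_mul(2)[OF linear_gen_cross]])
  then show "M = matrix (gen_cross b)" if "\<forall>x. M *v x = gen_cross b x" for M
    using that by (metis matrix_eq)
qed

lemma cross_matrix_mult: "cross_matrix b *v x = gen_cross b x"
  by (simp add: cross_matrix_eq fun_cong[OF matrix_vector_mul(2)[OF linear_gen_cross]])

lemma cross_matrix_nth:
  "cross_matrix b $ k $ l =
     (case pair_at k of (i, j) \<Rightarrow> (if l = j then b $ i else 0) - (if l = i then b $ j else 0))"
  by (auto simp: cross_matrix_eq matrix_def gen_cross_def axis_def split: prod.split)

lemma transpose_cross_matrix_mult_nth:
  fixes b :: "real^'n::{finite,linorder}" and c :: "real^'m::{finite,linorder}"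
  assumes "CARD('m) = CARD('n) * (CARD('n) - 1) div 2"
  shows "(transpose (cross_matrix b) *v c) $ k =
     (\<Sum>i | i < k. b $ i * c $ pair_pos i k) - (\<Sum>j | k < j. b $ j * c $ pair_pos k j)"
proof -
  have "(transpose (cross_matrix b) *v c) $ k = (\<Sum>q\<in>UNIV. cross_matrix b $ q $ k * c $ q)"
    by (simp add: matrix_vector_mult_def transpose_def)
  also have "\<dots> = (\<Sum>p\<in>(index_pairs :: ('n \<times> 'n) set). cross_matrix b $ (pair_pos (fst p) (snd p) :: 'm) $ k
                                   * c $ pair_pos (fst p) (snd p))"
    using sum.reindex_bij_betw[OF bij_betw_pair_pos[OF assms],
        of "\<lambda>q. cross_matrix b $ q $ k * c $ q"] by simp
  also have "\<dots> = (\<Sum>p\<in>(index_pairs :: ('n \<times> 'n) set).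
      (if snd p = k then b $ fst p * c $ pair_pos (fst p) k else 0)
      - (if fst p = k then b $ snd p * c $ pair_pos k (snd p) else 0))"
    by (rule sum.cong)
      (auto simp: cross_matrix_nth index_pairs_def pair_at_pair_pos[OF assms] algebra_simps)
  also have "\<dots> = (\<Sum>p\<in>{p \<in> index_pairs :: ('n \<times> 'n) set. snd p = k}. b $ fst p * c $ pair_pos (fst p) k)
      - (\<Sum>p\<in>{p \<in> index_pairs :: ('n \<times> 'n) set. fst p = k}. b $ snd p * c $ pair_pos k (snd p))"
    by (simp only: sum_subtractf sum.inter_filter[OF finite])
  also have "(\<Sum>p\<in>{p \<in> index_pairs :: ('n \<times> 'n) set. snd p = k}. b $ fst p * c $ pair_pos (fst p) k)
      = (\<Sum>i | i < k. b $ i * c $ pair_pos i k)"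
    by (rule sum.reindex_bij_witness[of _ "\<lambda>i. (i, k)" fst]) (auto simp: index_pairs_def)
  also have "(\<Sum>p\<in>{p \<in> index_pairs :: ('n \<times> 'n) set. fst p = k}. b $ snd p * c $ pair_pos k (snd p))
      = (\<Sum>j | k < j. b $ j * c $ pair_pos k j)"
    by (rule sum.reindex_bij_witness[of _ "\<lambda>j. (k, j)" snd]) (auto simp: index_pairs_def)
  finally show ?thesis .
qed

text \<open>The operators arise from \<open>cross_matrix b\<close> and its transpose by substituting \<open>\<partial>\<^sub>l\<close> for the
  coordinate \<open>b\<^sub>l\<close>.\<close>

lemma partial_nth:
  assumes "f differentiable (at x)"
  shows "partial l (\<lambda>z. f z $ k) x = partial l f x $ k"
proof -
  have "((\<lambda>z. f z $ k) has_derivative (\<lambda>h. frechet_derivative f (at x) h $ k)) (at x)"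
    using assms by (intro bounded_linear.has_derivative[OF bounded_linear_vec_nth])
      (simp add: frechet_derivative_works)
  from frechet_derivative_at[OF this] show ?thesis
    by (simp add: partial_def fun_eq_iff)
qed

lemma gen_curl_eq:
  assumes "a differentiable (at x)"
  shows "gen_curl a x = (\<Sum>l\<in>UNIV. cross_matrix (axis l 1) *v partial l a x)"
  by (simp add: vec_eq_iff gen_curl_def cross_matrix_mult gen_cross_def axis_def
      partial_nth[OF assms] sum_subtractf if_distrib[of "\<lambda>t. t * _"] split: prod.split cong: if_cong)

lemma cross_matrix_nabla_transpose_eq:
  fixes c :: "real^'n::{finite,linorder} \<Rightarrow> real^'m::{finite,linorder}"
  assumes "CARD('m) = CARD('n) * (CARD('n) - 1) div 2" and "c differentiable (at x)"
  shows "cross_matrix_nabla_transpose c x =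
     (\<Sum>l\<in>UNIV. transpose (cross_matrix (axis l 1)) *v partial l c x)"
proof -
  have "(\<Sum>l\<in>UNIV. \<Sum>i\<in>A. axis l 1 $ i * g l i) = (\<Sum>i\<in>A. g i i)"
    for A :: "'n set" and g :: "'n \<Rightarrow> 'n \<Rightarrow> real"
    by (subst sum.swap)
      (simp add: axis_def if_distrib[of "\<lambda>t. t * _"] cong: if_cong)
  then show ?thesis
    by (simp add: vec_eq_iff cross_matrix_nabla_transpose_def partial_nth[OF assms(2)]
        transpose_cross_matrix_mult_nth[OF assms(1)] sum_subtractf
        del: transpose_matrix_vector)
qed

end

theory Submission
  imports Defs
begin

text \<open>
  For a smooth compactly supported \<open>f\<close> let \<open>N f = \<integral> G(\<cdot>, y) f(y) dy\<close> be its Newtonian potential. The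
  theorem reduces to four properties of \<open>N\<close>. It commutes with partial derivatives
  (\<open>partial_newton_potential\<close>), because after the substitution \<open>z = x - y\<close> only \<open>f\<close> depends on \<open>x\<close>.
  The derivative can be moved onto the kernel,
  \<open>N(\<partial>\<^sub>i f) = (n \<omega>\<^sub>n)\<^sup>-\<^sup>1 \<integral> (x\<^sub>i - y\<^sub>i) |x - y|\<^sup>-\<^sup>n f(y) dy\<close> (\<open>convolution_radial_potential_partial\<close>).
  It inverts the Laplacian, \<open>N(\<Delta> f) = f\<close> (\<open>newton_potential_laplacian\<close>). And it commutes with
  bounded linear maps, so that all of this may be read componentwise.

  Put \<open>a_curl = \<nabla> N(div a)\<close>, whose components are \<open>N(\<partial>\<^sub>k div a)\<close>. Since mixed partials commute,
  the \<open>k\<close>-th component of \<open>M\<^sub>n(\<nabla>)\<^sup>T N(curl a)\<close> is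
  \<open>\<Sum>\<^sub>i N(\<partial>\<^sub>i \<partial>\<^sub>i a\<^sub>k - \<partial>\<^sub>k \<partial>\<^sub>i a\<^sub>i) = N(\<Delta> a\<^sub>k) - N(\<partial>\<^sub>k div a) = a\<^sub>k - (a_curl)\<^sub>k\<close>
  (\<open>newton_potential_curl_curl\<close>), which is the decomposition. The divergence of \<open>a - a_curl\<close> is
  \<open>div a - N(\<Delta> div a) = 0\<close>, and the curl of \<open>a_curl\<close> vanishes by symmetry of second derivatives. The
  integral formulas with kernel \<open>|x - y|\<^sup>-\<^sup>n\<close> come from moving the derivative onto the kernel; both are
  instances of one statement about first-order operators with constant coefficients
  (\<open>first_order_operator_newton_potential\<close>).

  The singularity of the kernels is handled without surface integrals or polar coordinates: the
  radius \<open>|z|\<close> is replaced by \<open>max |z| \<epsilon>\<close>. The truncated kernels are locally Lipschitz, and for such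
  functions integration by parts is just translation invariance of the Lebesgue measure applied to
  difference quotients (\<open>integration_by_parts\<close>). The divergence of the truncated field
  \<open>z (max |z| \<epsilon>)\<^sup>-\<^sup>n\<close> is \<open>n \<epsilon>\<^sup>-\<^sup>n\<close> on the ball of radius \<open>\<epsilon>\<close> and zero outside, so \<open>\<Delta> f\<close> is mapped to
  the mean of \<open>f\<close> over a ball, with the constant \<open>n \<omega>\<^sub>n\<close> in plain sight; then \<open>\<epsilon> \<rightarrow> 0\<close>.
\<close>

section \<open>Smooth functions with compact support\<close>

lemma C_infinity_differentiable:
  "C_infinity f \<Longrightarrow> f differentiable (at x)"
  unfolding C_infinity_def by (metis C_k.simps(2))

lemma C_infinity_frechet_derivative:
  "C_infinity f \<Longrightarrow> C_infinity (\<lambda>x. frechet_derivative f (at x) v)"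
  unfolding C_infinity_def by (metis C_k.simps(2))

lemma C_infinity_continuous_on:
  "C_infinity f \<Longrightarrow> continuous_on S f"
  unfolding C_infinity_def by (metis C_k.simps(1) continuous_on_subset subset_UNIV)

lemma C_k_zero: "C_k k (\<lambda>x. 0)"
  by (induction k) auto

lemma C_k_add:
  "C_k k f \<Longrightarrow> C_k k g \<Longrightarrow> C_k k (\<lambda>x. f x + g x)"
proof (induction k arbitrary: f g)
  case (Suc k)
  have "frechet_derivative (\<lambda>x. f x + g x) (at x)
      = (\<lambda>v. frechet_derivative f (at x) v + frechet_derivative g (at x) v)" for x
  proof (rule frechet_derivative_at[symmetric], rule has_derivative_add)
    show "(f has_derivative frechet_derivative f (at x)) (at x)"
      "(g has_derivative frechet_derivative g (at x)) (at x)"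
      using Suc.prems by (simp_all flip: frechet_derivative_works)
  qed
  with Suc show ?case by (auto intro: differentiable_add)
qed (auto intro: continuous_on_add)

lemma C_infinity_sum:
  "(\<And>i. i \<in> I \<Longrightarrow> C_infinity (f i)) \<Longrightarrow> C_infinity (\<lambda>x. \<Sum>i\<in>I. f i x)"
  by (induction I rule: infinite_finite_induct) (auto simp: C_infinity_def C_k_zero intro: C_k_add)

lemma frechet_derivative_bounded_linear:
  assumes "bounded_linear L" "f differentiable (at x)"
  shows "frechet_derivative (\<lambda>x. L (f x)) (at x) v = L (frechet_derivative f (at x) v)"
proof -
  have "((\<lambda>x. L (f x)) has_derivative (\<lambda>h. L (frechet_derivative f (at x) h))) (at x)"
    using assms by (intro bounded_linear.has_derivative[OF assms(1)])
      (simp add: frechet_derivative_works)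
  from frechet_derivative_at[OF this] show ?thesis by (simp add: fun_eq_iff)
qed

lemma C_k_bounded_linear:
  assumes L: "bounded_linear L"
  shows "C_k k f \<Longrightarrow> C_k k (\<lambda>x. L (f x))"
proof (induction k arbitrary: f)
  case 0
  then show ?case
    using L by (auto intro: bounded_linear.continuous_on)
next
  case (Suc k)
  have "(\<lambda>x. L (f x)) differentiable (at x)" for x
    using Suc.prems bounded_linear.has_derivative[OF L, of f]
    unfolding differentiable_def C_k.simps by blast
  with Suc L show ?case
    by (auto simp: frechet_derivative_bounded_linear)
qed

text \<open>The support condition is stated with a radius, which for maps into a normed space amounts to
  compact support and behaves better under reflections and translations of the argument.\<close>
definition test_fun :: "('a::euclidean_space \<Rightarrow> 'b::real_normed_vector) \<Rightarrow> bool" where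
  "test_fun f \<longleftrightarrow> C_infinity f \<and> (\<exists>R. \<forall>x. norm x > R \<longrightarrow> f x = 0)"

lemma test_funI:
  assumes "C_infinity f" "compactly_supported f"
  shows "test_fun f"
proof -
  have "bounded {x. f x \<noteq> 0}"
    using assms(2) by (simp add: compactly_supported_def compact_closure)
  then obtain R where "\<And>x. f x \<noteq> 0 \<Longrightarrow> norm x \<le> R"
    by (auto simp: bounded_iff)
  with assms(1) show ?thesis
    unfolding test_fun_def by (meson not_le)
qed

lemma test_fun_continuous_on: "test_fun f \<Longrightarrow> continuous_on S f"
  by (simp add: test_fun_def C_infinity_continuous_on)

lemma test_fun_measurable: "test_fun f \<Longrightarrow> f \<in> borel_measurable borel"
  by (simp add: test_fun_continuous_on borel_measurable_continuous_onI)

lemma test_fun_bounded_support: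
  assumes "test_fun f"
  obtains R where "R > 0" "\<And>x. norm x > R \<Longrightarrow> f x = 0"
proof -
  obtain R where R: "\<And>x. norm x > R \<Longrightarrow> f x = 0"
    using assms by (auto simp: test_fun_def)
  show thesis by (rule that[of "max R 1"]) (auto intro: R)
qed

lemma test_fun_bounded:
  assumes "test_fun f"
  obtains B where "B > 0" "\<And>x. norm (f x) \<le> B"
proof -
  obtain R where R: "R > 0" "\<And>x. norm x > R \<Longrightarrow> f x = 0"
    using test_fun_bounded_support[OF assms] by blast
  have "compact (f ` cball 0 R)"
    by (intro compact_continuous_image test_fun_continuous_on[OF assms]) simp
  then obtain B where B: "B > 0" "\<And>x. norm x \<le> R \<Longrightarrow> norm (f x) \<le> B"
    by (auto simp: bounded_pos dest!: compact_imp_bounded)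
  show thesis
  proof (rule that[OF B(1)])
    show "norm (f x) \<le> B" for x
      using B R(2)[of x] by (cases "norm x \<le> R") auto
  qed
qed

lemma test_fun_uniformly_continuous:
  assumes "test_fun f"
  shows "uniformly_continuous_on UNIV f"
  unfolding uniformly_continuous_on_def
proof (intro allI impI)
  fix e :: real assume "e > 0"
  obtain R where R: "R > 0" "\<And>x. norm x > R \<Longrightarrow> f x = 0"
    using test_fun_bounded_support[OF assms] by blast
  have "uniformly_continuous_on (cball 0 (R + 1)) f"
    by (intro compact_uniformly_continuous test_fun_continuous_on[OF assms]) simp
  then obtain d where d: "d > 0"
    "\<And>x y. norm x \<le> R + 1 \<Longrightarrow> norm y \<le> R + 1 \<Longrightarrow> dist y x < d \<Longrightarrow> dist (f y) (f x) < e"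
    using \<open>e > 0\<close> unfolding uniformly_continuous_on_def by auto
  have "dist (f y) (f x) < e" if "dist y x < min d 1" for x y
  proof (cases "norm x \<le> R + 1 \<and> norm y \<le> R + 1")
    case True then show ?thesis using d that by auto
  next
    case False
    have "norm x \<le> norm y + dist y x" "norm y \<le> norm x + dist y x"
      using norm_triangle_ineq2[of x y] norm_triangle_ineq2[of y x]
      by (auto simp: dist_norm norm_minus_commute)
    then have "norm x > R" "norm y > R" using False that by auto
    then show ?thesis using R(2) \<open>e > 0\<close> by simp
  qed
  then show "\<exists>d>0. \<forall>x\<in>UNIV. \<forall>y\<in>UNIV. dist y x < d \<longrightarrow> dist (f y) (f x) < e"
    using d(1) by (intro exI[of _ "min d 1"]) auto
qed

lemma test_fun_bounded_linear:
  assumes "bounded_linear L" "test_fun f"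
  shows "test_fun (\<lambda>x. L (f x))"
  using assms unfolding test_fun_def C_infinity_def
  by (metis C_k_bounded_linear linear_simps(3))

lemma test_fun_nth: "test_fun f \<Longrightarrow> test_fun (\<lambda>x. f x $ i)"
  by (rule test_fun_bounded_linear[OF bounded_linear_vec_nth])

lemma test_fun_sum:
  assumes "finite I" "\<And>i. i \<in> I \<Longrightarrow> test_fun (f i)"
  shows "test_fun (\<lambda>x. \<Sum>i\<in>I. f i x)"
proof -
  have "\<forall>i\<in>I. \<exists>R. \<forall>x. norm x > R \<longrightarrow> f i x = 0"
    using assms by (auto simp: test_fun_def)
  then obtain R where R: "\<And>i x. i \<in> I \<Longrightarrow> norm x > R i \<Longrightarrow> f i x = 0"
    by metis
  have "(\<Sum>i\<in>I. f i x) = 0" if "norm x > Max (insert 0 (R ` I))" for x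
    using that assms(1) by (intro sum.neutral ballI R) auto
  moreover have "C_infinity (\<lambda>x. \<Sum>i\<in>I. f i x)"
    using assms by (intro C_infinity_sum) (simp add: test_fun_def)
  ultimately show ?thesis
    unfolding test_fun_def by blast
qed

lemma partial_eq_0_outside:
  assumes R: "\<And>x. norm x > R \<Longrightarrow> f x = 0" and "norm x > R"
  shows "partial i f x = 0"
proof -
  have "(f has_derivative (\<lambda>h. 0)) (at x)"
  proof (rule has_derivative_transform_within_open)
    show "((\<lambda>x. 0) has_derivative (\<lambda>h. 0)) (at x)" by simp
    show "open (- cball 0 R)" by (simp add: open_Compl)
  qed (use assms in auto)
  from frechet_derivative_at[OF this] show ?thesis
    by (metis partial_def)
qed

lemma test_fun_partial:
  assumes "test_fun f"
  shows "test_fun (partial i f)"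
proof -
  have "C_infinity (partial i f)"
    using assms C_infinity_frechet_derivative[of f "axis i 1"]
    by (simp add: test_fun_def partial_def[abs_def])
  moreover obtain R where "\<And>x. norm x > R \<Longrightarrow> f x = 0"
    using assms by (auto simp: test_fun_def)
  ultimately show ?thesis
    using partial_eq_0_outside[of R f] by (auto simp: test_fun_def)
qed

lemma frechet_derivative_partial:
  assumes "f differentiable (at x)"
  shows "frechet_derivative f (at x) h = (\<Sum>i\<in>UNIV. h $ i *\<^sub>R partial i f x)"
proof -
  interpret linear "frechet_derivative f (at x)"
    by (rule linear_frechet_derivative[OF assms])
  have "frechet_derivative f (at x) h = frechet_derivative f (at x) (\<Sum>i\<in>UNIV. h $ i *\<^sub>R axis i 1)"
    using basis_expansion[of h] by (simp add: scalar_mult_eq_scaleR)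
  then show ?thesis by (simp add: sum scaleR partial_def)
qed

lemma test_fun_has_derivative:
  assumes "test_fun f"
  shows "(f has_derivative (\<lambda>h. \<Sum>i\<in>UNIV. h $ i *\<^sub>R partial i f x)) (at x within S)"
  using assms C_infinity_differentiable[of f x]
  by (auto simp: test_fun_def frechet_derivative_works frechet_derivative_partial[symmetric]
        intro: has_derivative_at_withinI)

text \<open>For reading off partial derivatives of functions, such as potentials, whose total derivative is
  known but which are not compactly supported.\<close>
lemma partial_eqI:
  assumes "(f has_derivative (\<lambda>h. \<Sum>i\<in>UNIV. h $ i *\<^sub>R g i)) (at x)"
  shows "partial i f x = g i"
proof -
  have "partial i f x = (\<Sum>j\<in>UNIV. axis i 1 $ j *\<^sub>R g j)"
    unfolding partial_def frechet_derivative_at[OF assms, symmetric] ..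
  then show ?thesis by (simp add: axis_def if_distrib[of "\<lambda>t. t *\<^sub>R _"] cong: if_cong)
qed

lemma onorm_sum_nth_le:
  fixes g :: "'n::finite \<Rightarrow> 'b::real_normed_vector"
  shows "onorm (\<lambda>h. \<Sum>i\<in>UNIV. h $ i *\<^sub>R g i) \<le> (\<Sum>i\<in>UNIV. norm (g i))"
proof (rule onorm_le)
  fix h :: "real^'n"
  have "norm (\<Sum>i\<in>UNIV. h $ i *\<^sub>R g i) \<le> (\<Sum>i\<in>UNIV. norm h * norm (g i))"
    by (rule sum_norm_le) (simp add: component_le_norm_cart mult_right_mono)
  then show "norm (\<Sum>i\<in>UNIV. h $ i *\<^sub>R g i) \<le> (\<Sum>i\<in>UNIV. norm (g i)) * norm h"
    by (simp add: sum_distrib_left mult.commute)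
qed

lemma test_fun_lipschitz:
  fixes f :: "real^'n::finite \<Rightarrow> 'b::real_normed_vector"
  assumes "test_fun f"
  obtains L where "L-lipschitz_on UNIV f"
proof -
  have "\<exists>B. \<forall>x. norm (partial i f x) \<le> B" for i
    using test_fun_bounded[OF test_fun_partial[OF assms, of i]] by metis
  then obtain B where B: "norm (partial i f x) \<le> B i" for i x by metis
  show thesis
  proof (rule that, rule bounded_derivative_imp_lipschitz)
    show "(f has_derivative (\<lambda>h. \<Sum>i\<in>UNIV. h $ i *\<^sub>R partial i f x)) (at x within UNIV)" for x
      by (rule test_fun_has_derivative[OF assms])
    show "onorm (\<lambda>h. \<Sum>i\<in>UNIV. h $ i *\<^sub>R partial i f x) \<le> (\<Sum>i\<in>UNIV. B i)" for x
      by (rule order_trans[OF onorm_sum_nth_le sum_mono[OF B]])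
    show "0 \<le> (\<Sum>i\<in>UNIV. B i)"
      by (rule sum_nonneg) (meson B norm_ge_zero order_trans)
  qed simp
qed

text \<open>The linearization error is small uniformly in the base point. This is what survives integration
  against a kernel and so yields total differentiability of convolutions.\<close>
lemma test_fun_uniform_linearization:
  fixes f :: "real^'n::finite \<Rightarrow> 'b::real_normed_vector"
  assumes "test_fun f" "e > 0"
  obtains d where "d > 0"
    "\<And>x h. norm h < d \<Longrightarrow> norm (f (x + h) - f x - (\<Sum>i\<in>UNIV. h $ i *\<^sub>R partial i f x)) \<le> e * norm h"
proof -
  define e' where "e' = e / real CARD('n)"
  have "e' > 0" using assms(2) by (simp add: e'_def)
  have "\<exists>d>0. \<forall>x y. dist y x < d \<longrightarrow> dist (partial i f y) (partial i f x) < e'" for i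
    using test_fun_uniformly_continuous[OF test_fun_partial[OF assms(1), of i]] \<open>e' > 0\<close>
    unfolding uniformly_continuous_on_def by auto
  then obtain d where d: "\<And>i. d i > 0"
      "\<And>i x y. dist y x < d i \<Longrightarrow> dist (partial i f y) (partial i f x) < e'"
    by metis
  define D where "D = Min (range d)"
  have D: "D > 0" "\<And>i. D \<le> d i" by (auto simp: D_def d)
  show thesis
  proof (rule that[OF D(1)])
    fix x h :: "real^'n" assume h: "norm h < D"
    have "norm (f (x + h) - f x - (\<Sum>i\<in>UNIV. (x + h - x) $ i *\<^sub>R partial i f x)) \<le> norm (x + h - x) * e"
    proof (rule differentiable_bound_linearization[where S = "ball x D"])
      show "x + t *\<^sub>R (x + h - x) \<in> ball x D" if "t \<in> {0..1}" for t
        using that h mult_right_mono[of t 1 "norm h"] by (auto simp: dist_norm)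
      show "(f has_derivative (\<lambda>h. \<Sum>i\<in>UNIV. h $ i *\<^sub>R partial i f y)) (at y within ball x D)" for y
        by (rule test_fun_has_derivative[OF assms(1)])
      show "onorm ((\<lambda>v. \<Sum>i\<in>UNIV. v $ i *\<^sub>R partial i f y) - (\<lambda>v. \<Sum>i\<in>UNIV. v $ i *\<^sub>R partial i f x)) \<le> e"
        if "y \<in> ball x D" for y
      proof -
        have "norm (partial i f y - partial i f x) \<le> e'" for i
          using d(2)[of y x i] D(2)[of i] that by (auto simp: dist_norm norm_minus_commute)
        then have "(\<Sum>i\<in>UNIV. norm (partial i f y - partial i f x)) \<le> (\<Sum>i\<in>(UNIV::'n set). e')"
          by (rule sum_mono)
        then have *: "(\<Sum>i\<in>UNIV. norm (partial i f y - partial i f x)) \<le> e"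
          by (simp add: e'_def)
        show ?thesis
          using order_trans[OF onorm_sum_nth_le[of "\<lambda>i. partial i f y - partial i f x"] *]
          by (simp add: scaleR_diff_right sum_subtractf fun_diff_def)
      qed
    qed (use D in simp)
    then show "norm (f (x + h) - f x - (\<Sum>i\<in>UNIV. h $ i *\<^sub>R partial i f x)) \<le> e * norm h"
      by (simp add: mult.commute)
  qed
qed

lemma partial_bounded_linear:
  assumes "bounded_linear L" "f differentiable (at x)"
  shows "partial i (\<lambda>x. L (f x)) x = L (partial i f x)"
  unfolding partial_def by (rule frechet_derivative_bounded_linear[OF assms])

lemma partial_sum:
  assumes "finite I" "\<And>j. j \<in> I \<Longrightarrow> test_fun (f j)"
  shows "partial i (\<lambda>x. \<Sum>j\<in>I. f j x) x = (\<Sum>j\<in>I. partial i (f j) x)"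
proof (rule partial_eqI)
  have "((\<lambda>x. \<Sum>j\<in>I. f j x) has_derivative (\<lambda>h. \<Sum>j\<in>I. \<Sum>i\<in>UNIV. h $ i *\<^sub>R partial i (f j) x)) (at x)"
    by (intro has_derivative_sum test_fun_has_derivative assms)
  also have "(\<lambda>h. \<Sum>j\<in>I. \<Sum>i\<in>UNIV. h $ i *\<^sub>R partial i (f j) x) =
      (\<lambda>h. \<Sum>i\<in>UNIV. h $ i *\<^sub>R (\<Sum>j\<in>I. partial i (f j) x))"
    by (subst sum.swap) (simp add: scaleR_sum_right)
  finally show "((\<lambda>x. \<Sum>j\<in>I. f j x) has_derivative \<dots>) (at x)" .
qed

section \<open>Symmetry of second derivatives\<close>

lemma test_fun_has_field_derivative_line:
  fixes f :: "real^'n::finite \<Rightarrow> real"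
  assumes "test_fun f"
  shows "((\<lambda>t. f (x + t *\<^sub>R axis i 1)) has_real_derivative partial i f (x + t *\<^sub>R axis i 1)) (at t)"
proof -
  have "((\<lambda>t. f (x + t *\<^sub>R axis i 1)) has_derivative
      (\<lambda>s. \<Sum>j\<in>UNIV. (s *\<^sub>R axis i 1) $ j *\<^sub>R partial j f (x + t *\<^sub>R axis i 1))) (at t)"
    by (rule has_derivative_compose[OF _ test_fun_has_derivative[OF assms]])
      (auto intro!: derivative_eq_intros)
  also have "(\<lambda>s. \<Sum>j\<in>UNIV. (s *\<^sub>R axis i 1) $ j *\<^sub>R partial j f (x + t *\<^sub>R axis i 1)) =
      (\<lambda>s. s * partial i f (x + t *\<^sub>R axis i 1))"
    by (simp add: axis_def if_distrib[of "\<lambda>t. _ * t"] if_distrib[of "\<lambda>t. t * _"] cong: if_cong)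
  finally show ?thesis by (simp add: has_field_derivative_def mult.commute[of _ "partial _ _ _"])
qed

text \<open>Two applications of the mean value theorem, first along \<open>i\<close> and then along \<open>j\<close>. The left-hand
  side is symmetric in \<open>i\<close> and \<open>j\<close>, the order of the derivatives on the right is not; letting \<open>s\<close>
  tend to \<open>0\<close> therefore exchanges them.\<close>
lemma second_difference_mvt:
  fixes f :: "real^'n::finite \<Rightarrow> real"
  assumes f: "test_fun f" and "s > 0"
  obtains \<xi> \<eta> where "0 \<le> \<xi>" "\<xi> \<le> s" "0 \<le> \<eta>" "\<eta> \<le> s"
    "f (x + s *\<^sub>R axis i 1 + s *\<^sub>R axis j 1) - f (x + s *\<^sub>R axis i 1) - f (x + s *\<^sub>R axis j 1) + f x
       = s * s * partial j (partial i f) (x + \<xi> *\<^sub>R axis i 1 + \<eta> *\<^sub>R axis j 1)"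
proof -
  define g where "g = (\<lambda>t. f ((x + s *\<^sub>R axis j 1) + t *\<^sub>R axis i 1) - f (x + t *\<^sub>R axis i 1))"
  have "\<exists>\<xi>>0. \<xi> < s \<and> g s - g 0 = (s - 0) *
      (partial i f ((x + s *\<^sub>R axis j 1) + \<xi> *\<^sub>R axis i 1) - partial i f (x + \<xi> *\<^sub>R axis i 1))"
    unfolding g_def
    by (rule MVT2[OF \<open>s > 0\<close>])
      (intro DERIV_diff test_fun_has_field_derivative_line[OF f])
  then obtain \<xi> where \<xi>: "0 < \<xi>" "\<xi> < s" "g s - g 0 = s *
      (partial i f ((x + s *\<^sub>R axis j 1) + \<xi> *\<^sub>R axis i 1) - partial i f (x + \<xi> *\<^sub>R axis i 1))"
    by auto
  have "\<exists>\<eta>>0. \<eta> < s \<and> partial i f ((x + \<xi> *\<^sub>R axis i 1) + s *\<^sub>R axis j 1)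
        - partial i f ((x + \<xi> *\<^sub>R axis i 1) + 0 *\<^sub>R axis j 1)
      = (s - 0) * partial j (partial i f) ((x + \<xi> *\<^sub>R axis i 1) + \<eta> *\<^sub>R axis j 1)"
    by (rule MVT2[OF \<open>s > 0\<close>])
      (intro test_fun_has_field_derivative_line test_fun_partial[OF f])
  then obtain \<eta> where \<eta>: "0 < \<eta>" "\<eta> < s" "partial i f ((x + \<xi> *\<^sub>R axis i 1) + s *\<^sub>R axis j 1)
        - partial i f (x + \<xi> *\<^sub>R axis i 1)
      = s * partial j (partial i f) ((x + \<xi> *\<^sub>R axis i 1) + \<eta> *\<^sub>R axis j 1)"
    by auto
  have "f (x + s *\<^sub>R axis i 1 + s *\<^sub>R axis j 1) - f (x + s *\<^sub>R axis i 1) - f (x + s *\<^sub>R axis j 1) + f x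
      = g s - g 0"
    by (simp add: g_def algebra_simps)
  also have "\<dots> = s * s * partial j (partial i f) (x + \<xi> *\<^sub>R axis i 1 + \<eta> *\<^sub>R axis j 1)"
    using \<xi>(3) \<eta>(3) by (simp add: add_ac)
  finally show thesis using that[of \<xi> \<eta>] \<xi> \<eta> by simp
qed

lemma partial_commute:
  fixes f :: "real^'n::finite \<Rightarrow> real"
  assumes f: "test_fun f"
  shows "partial j (partial i f) x = partial i (partial j f) x"
proof -
  define s where "s = (\<lambda>k. inverse (real (Suc k)))"
  have s: "s k > 0" for k by (simp add: s_def)
  have s0: "s \<longlonglongrightarrow> 0" unfolding s_def by (rule LIMSEQ_inverse_real_of_nat)
  let ?D = "\<lambda>k i j. f (x + s k *\<^sub>R axis i 1 + s k *\<^sub>R axis j 1) - f (x + s k *\<^sub>R axis i 1)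
     - f (x + s k *\<^sub>R axis j 1) + f x"
  have lim: "(\<lambda>k. ?D k i j / (s k * s k)) \<longlonglongrightarrow> partial j (partial i f) x" for i j
  proof -
    have "\<exists>\<xi> \<eta>. 0 \<le> \<xi> \<and> \<xi> \<le> s k \<and> 0 \<le> \<eta> \<and> \<eta> \<le> s k \<and>
        ?D k i j = s k * s k * partial j (partial i f) (x + \<xi> *\<^sub>R axis i 1 + \<eta> *\<^sub>R axis j 1)" for k
      using second_difference_mvt[OF f s] by metis
    then obtain \<xi> \<eta> where *: "\<And>k. 0 \<le> \<xi> k" "\<And>k. \<xi> k \<le> s k" "\<And>k. 0 \<le> \<eta> k" "\<And>k. \<eta> k \<le> s k"
        "\<And>k. ?D k i j = s k * s k * partial j (partial i f) (x + \<xi> k *\<^sub>R axis i 1 + \<eta> k *\<^sub>R axis j 1)"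
      by metis
    have "\<xi> \<longlonglongrightarrow> 0" "\<eta> \<longlonglongrightarrow> 0"
      by (rule tendsto_sandwich[OF _ _ tendsto_const s0]; simp add: *)+
    then have "(\<lambda>k. x + \<xi> k *\<^sub>R axis i 1 + \<eta> k *\<^sub>R axis j 1) \<longlonglongrightarrow> x + 0 *\<^sub>R axis i 1 + 0 *\<^sub>R axis j 1"
      by (intro tendsto_intros)
    then have "(\<lambda>k. partial j (partial i f) (x + \<xi> k *\<^sub>R axis i 1 + \<eta> k *\<^sub>R axis j 1))
        \<longlonglongrightarrow> partial j (partial i f) x"
      using continuous_on_tendsto_compose[OF test_fun_continuous_on[OF test_fun_partial[OF test_fun_partial[OF f]], of UNIV]]
      by simp
    moreover have "?D k i j / (s k * s k) = partial j (partial i f) (x + \<xi> k *\<^sub>R axis i 1 + \<eta> k *\<^sub>R axis j 1)" for k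
      using s[of k] unfolding *(5) by simp
    ultimately show ?thesis by simp
  qed
  have swap: "?D k j i = ?D k i j" for k by (simp add: add_ac)
  show ?thesis
    by (rule LIMSEQ_unique[OF lim[of i j] lim[of j i, unfolded swap]])
qed

section \<open>Convolution with locally integrable kernels\<close>

lemma distr_lborel_reflect: "distr lborel borel (\<lambda>y. x - y) = (lborel :: 'a::euclidean_space measure)"
  by (subst (2) lborel_affine[of "-1" x]) (auto simp: density_1 one_ennreal_def[symmetric])

lemma
  fixes g :: "'a::euclidean_space \<Rightarrow> 'b::{banach, second_countable_topology}"
  assumes [measurable]: "g \<in> borel_measurable borel"
  shows integrable_lborel_reflect: "integrable lborel (\<lambda>y. g (x - y)) \<longleftrightarrow> integrable lborel g"
    and integral_lborel_reflect: "(\<integral>y. g (x - y) \<partial>lborel) = (\<integral>y. g y \<partial>lborel)"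
proof -
  have "integrable lborel g \<longleftrightarrow> integrable (distr lborel borel (\<lambda>y. x - y)) g"
    by (simp only: distr_lborel_reflect)
  also have "\<dots> \<longleftrightarrow> integrable lborel (\<lambda>y. g (x - y))"
    by (rule integrable_distr_eq) auto
  finally show "integrable lborel (\<lambda>y. g (x - y)) \<longleftrightarrow> integrable lborel g" ..
  have "(\<integral>y. g y \<partial>lborel) = (\<integral>y. g y \<partial>distr lborel borel (\<lambda>y. x - y))"
    by (simp only: distr_lborel_reflect)
  also have "\<dots> = (\<integral>y. g (x - y) \<partial>lborel)"
    by (rule integral_distr) auto
  finally show "(\<integral>y. g (x - y) \<partial>lborel) = (\<integral>y. g y \<partial>lborel)" ..
qed

lemma
  fixes g :: "'a::euclidean_space \<Rightarrow> 'b::{banach, second_countable_topology}"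
  assumes [measurable]: "g \<in> borel_measurable borel"
  shows integrable_lborel_translate: "integrable lborel (\<lambda>y. g (c + y)) \<longleftrightarrow> integrable lborel g"
    and integral_lborel_translate: "(\<integral>y. g (c + y) \<partial>lborel) = (\<integral>y. g y \<partial>lborel)"
proof -
  have "integrable lborel g \<longleftrightarrow> integrable (distr lborel borel ((+) c)) g"
    by (simp only: lborel_distr_plus)
  also have "\<dots> \<longleftrightarrow> integrable lborel (\<lambda>y. g (c + y))"
    by (rule integrable_distr_eq) auto
  finally show "integrable lborel (\<lambda>y. g (c + y)) \<longleftrightarrow> integrable lborel g" ..
  have "(\<integral>y. g y \<partial>lborel) = (\<integral>y. g y \<partial>distr lborel borel ((+) c))"
    by (simp only: lborel_distr_plus)
  also have "\<dots> = (\<integral>y. g (c + y) \<partial>lborel)"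
    by (rule integral_distr) auto
  finally show "(\<integral>y. g (c + y) \<partial>lborel) = (\<integral>y. g y \<partial>lborel)" ..
qed

definition locally_integrable :: "('a::euclidean_space \<Rightarrow> real) \<Rightarrow> bool" where
  "locally_integrable \<phi> \<longleftrightarrow> \<phi> \<in> borel_measurable borel \<and> (\<forall>R. set_integrable lborel (cball 0 R) \<phi>)"

lemma locally_integrable_measurable: "locally_integrable \<phi> \<Longrightarrow> \<phi> \<in> borel_measurable borel"
  by (simp add: locally_integrable_def)

lemma integrable_locally_integrable_mult:
  fixes F :: "'a::euclidean_space \<Rightarrow> 'b::{banach, second_countable_topology}"
  assumes \<phi>: "locally_integrable \<phi>" and F [measurable]: "F \<in> borel_measurable borel"
    and B: "\<And>z. norm (F z) \<le> B" and R: "\<And>z. norm z > R \<Longrightarrow> F z = 0"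
  shows "integrable lborel (\<lambda>z. \<phi> z *\<^sub>R F z)"
proof (rule Bochner_Integration.integrable_bound)
  have [measurable]: "\<phi> \<in> borel_measurable borel"
    using \<phi> by (rule locally_integrable_measurable)
  show "(\<lambda>z. \<phi> z *\<^sub>R F z) \<in> borel_measurable lborel" by measurable
  show "integrable lborel (\<lambda>z. B *\<^sub>R (indicator (cball 0 R) z *\<^sub>R \<phi> z))"
    using \<phi> unfolding locally_integrable_def set_integrable_def
    by (intro integrable_scaleR_right) blast
  show "AE z in lborel. norm (\<phi> z *\<^sub>R F z) \<le> norm (B *\<^sub>R (indicator (cball 0 R) z *\<^sub>R \<phi> z))"
  proof (intro AE_I2)
    fix z
    have "B \<ge> 0" using B[of z] norm_ge_zero order_trans by blast
    then show "norm (\<phi> z *\<^sub>R F z) \<le> norm (B *\<^sub>R (indicator (cball 0 R) z *\<^sub>R \<phi> z))"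
      using B[of z] R[of z] by (cases "norm z \<le> R") (auto simp: indicator_def abs_mult mult.commute[of B] mult_left_mono)
  qed
qed

lemma test_fun_reflect:
  fixes f :: "'a::euclidean_space \<Rightarrow> 'b::real_normed_vector"
  assumes "test_fun f"
  obtains R where "R > 0" "\<And>z. norm z > R \<Longrightarrow> f (x - z) = 0"
proof -
  obtain R where R: "R > 0" "\<And>x. norm x > R \<Longrightarrow> f x = 0"
    using test_fun_bounded_support[OF assms] by blast
  have "f (x - z) = 0" if "norm z > R + norm x" for z
    using that norm_triangle_ineq2[of z x] by (intro R(2)) (simp add: norm_minus_commute)
  with R(1) show thesis
    by (intro that[of "R + norm x"]) (auto intro: add_pos_nonneg)
qed

lemma measurable_reflect:
  fixes f :: "'a::euclidean_space \<Rightarrow> 'b::{banach, second_countable_topology}"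
  assumes "test_fun f"
  shows "(\<lambda>z. f (x - z)) \<in> borel_measurable borel"
  using measurable_compose[OF _ test_fun_measurable[OF assms], of "\<lambda>z. x - z" borel] by simp

lemma convolution_integrable:
  fixes f :: "'a::euclidean_space \<Rightarrow> 'b::{banach, second_countable_topology}"
  assumes "locally_integrable \<phi>" "test_fun f"
  shows "integrable lborel (\<lambda>z. \<phi> z *\<^sub>R f (x - z))"
  using test_fun_bounded[OF assms(2)] test_fun_reflect[OF assms(2), of x]
    integrable_locally_integrable_mult[OF assms(1) measurable_reflect[OF assms(2)]]
  by metis

text \<open>The theorem places the singularity at \<open>x\<close>; for estimates and derivatives it is moved to the
  origin, where it no longer depends on \<open>x\<close>.\<close>
lemma
  fixes f :: "'a::euclidean_space \<Rightarrow> 'b::{banach, second_countable_topology}"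
  assumes "locally_integrable \<phi>" "test_fun f"
  shows convolution_commute_integrable: "integrable lborel (\<lambda>y. \<phi> (x - y) *\<^sub>R f y)"
    and convolution_commute: "(\<integral>y. \<phi> (x - y) *\<^sub>R f y \<partial>lborel) = (\<integral>z. \<phi> z *\<^sub>R f (x - z) \<partial>lborel)"
proof -
  have [measurable]: "\<phi> \<in> borel_measurable borel" "(\<lambda>z. f (x - z)) \<in> borel_measurable borel"
    using assms by (auto intro: locally_integrable_measurable measurable_reflect)
  have m: "(\<lambda>z. \<phi> z *\<^sub>R f (x - z)) \<in> borel_measurable borel" by measurable
  show "integrable lborel (\<lambda>y. \<phi> (x - y) *\<^sub>R f y)"
    using integrable_lborel_reflect[OF m, of x] convolution_integrable[OF assms, of x] by simp
  show "(\<integral>y. \<phi> (x - y) *\<^sub>R f y \<partial>lborel) = (\<integral>z. \<phi> z *\<^sub>R f (x - z) \<partial>lborel)"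
    using integral_lborel_reflect[OF m, of x] by simp
qed

lemma dyadic_scale:
  fixes r :: real
  assumes "0 < r" "r \<le> 1"
  obtains k :: nat where "1 / 2 ^ Suc k < r" "r \<le> 1 / 2 ^ k"
proof -
  obtain m :: nat where m: "(1/2) ^ m < r"
    using real_arch_pow_inv[OF assms(1), of "1/2"] by auto
  define l where "l = (LEAST m. (1/2) ^ m < r)"
  have l: "(1/2) ^ l < r" unfolding l_def by (rule LeastI[of "\<lambda>m. (1/2) ^ m < r", OF m])
  then have "l \<noteq> 0" using assms(2) by (cases l) auto
  then obtain k where k: "l = Suc k" by (cases l) auto
  have "\<not> (1/2) ^ k < r" using not_less_Least[of k "\<lambda>m. (1/2) ^ m < r"] k unfolding l_def by simp
  with l k show thesis by (intro that[of k]) (auto simp: power_divide)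
qed

text \<open>On the shell \<open>2\<^sup>-\<^sup>k\<^sup>-\<^sup>1 < |y| \<le> 2\<^sup>-\<^sup>k\<close> the function is at most \<open>2\<close> to the power \<open>(k + 1)(n - 1)\<close>,
  while the ball of radius \<open>2\<^sup>-\<^sup>k\<close> has volume proportional to \<open>2\<^sup>-\<^sup>k\<^sup>n\<close>. The contributions form a
  geometric series with ratio \<open>1/2\<close>.\<close>
lemma set_integrable_inverse_norm_power:
  assumes n: "CARD('n::finite) \<ge> 2"
  shows "set_integrable lborel (cball 0 1) (\<lambda>y::real^'n. inverse (norm y) ^ (CARD('n) - 1))"
proof -
  obtain p where p: "CARD('n) = Suc p" "p \<ge> 1"
    using n by (cases "CARD('n)") auto
  define c :: "nat \<Rightarrow> real" where "c k = 2 ^ (Suc k * p)" for k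
  have c0: "c k \<ge> 0" for k by (simp add: c_def)
  have pointwise: "ennreal (norm (indicator (cball 0 1) y *\<^sub>R inverse (norm y) ^ p)) \<le>
      (\<Sum>k. ennreal (c k) * indicator (cball 0 (1 / 2 ^ k)) y)" for y :: "real^'n"
  proof (cases "y \<noteq> 0 \<and> norm y \<le> 1")
    case True
    then obtain k where k: "1 / 2 ^ Suc k < norm y" "norm y \<le> 1 / 2 ^ k"
      using dyadic_scale[of "norm y"] by auto
    have "inverse (norm y) \<le> inverse (1 / 2 ^ Suc k)"
      using k(1) by (intro le_imp_inverse_le) auto
    then have "inverse (norm y) ^ p \<le> (2 ^ Suc k) ^ p"
      by (intro power_mono) auto
    then have "ennreal (norm (indicator (cball 0 1) y *\<^sub>R inverse (norm y) ^ p)) \<le>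
        ennreal (c k) * indicator (cball 0 (1 / 2 ^ k)) y"
      using True k(2) by (simp add: c_def power_add power_mult power_mult_distrib indicator_def)
    also have "\<dots> \<le> (\<Sum>k. ennreal (c k) * indicator (cball 0 (1 / 2 ^ k)) y)"
      using sum_le_suminf[OF summableI, of "{k}" "\<lambda>k. ennreal (c k) * indicator (cball 0 (1 / 2 ^ k)) y"]
      by (simp del: sum_mult_indicator)
    finally show ?thesis .
  next
    case False
    then have "norm (indicator (cball 0 1) y *\<^sub>R inverse (norm y) ^ p) = 0"
      using p(2) by (auto simp: indicator_def)
    then show ?thesis by (simp only:) simp
  qed
  have "(\<integral>\<^sup>+y. ennreal (norm (indicator (cball 0 1) (y::real^'n) *\<^sub>R inverse (norm y) ^ p)) \<partial>lborel)
      \<le> (\<integral>\<^sup>+y. (\<Sum>k. ennreal (c k) * indicator (cball 0 (1 / 2 ^ k)) (y::real^'n)) \<partial>lborel)"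
    by (intro nn_integral_mono pointwise)
  also have "\<dots> = (\<Sum>k. ennreal (c k) * emeasure lborel (cball (0::real^'n) (1 / 2 ^ k)))"
    by (subst nn_integral_suminf)
      (auto simp: nn_integral_cmult_indicator intro!: borel_measurable_times_ennreal borel_measurable_indicator)
  also have "\<dots> = (\<Sum>k. ennreal (2 ^ p * unit_ball_vol (Suc p) * (1/2) ^ k))"
  proof (rule suminf_cong)
    fix k
    have "c k * (1 / 2 ^ k) ^ Suc p = 2 ^ p * (1/2) ^ k"
      by (simp add: c_def power_add power_mult field_simps flip: power_mult)
    then have *: "c k * (unit_ball_vol (Suc p) * (1 / 2 ^ k) ^ Suc p) = 2 ^ p * unit_ball_vol (Suc p) * (1/2) ^ k"
      by (metis (no_types, opaque_lifting) mult.assoc mult.commute)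
    have "emeasure lborel (cball (0::real^'n) (1 / 2 ^ k)) = ennreal (unit_ball_vol (Suc p) * (1 / 2 ^ k) ^ Suc p)"
      by (subst emeasure_cball) (simp_all add: p(1))
    then show "ennreal (c k) * emeasure lborel (cball (0::real^'n) (1 / 2 ^ k)) =
        ennreal (2 ^ p * unit_ball_vol (Suc p) * (1/2) ^ k)"
      using c0[of k] * by (simp only: ennreal_mult'[symmetric])
  qed
  also have "\<dots> < \<infinity>"
    unfolding infinity_ennreal_def less_top[symmetric]
    by (rule ennreal_suminf_neq_top) (auto intro!: summable_mult summable_geometric)
  finally have "integrable lborel (\<lambda>y::real^'n. indicator (cball 0 1) y *\<^sub>R inverse (norm y) ^ p)"
    by (intro integrableI_bounded borel_measurable_scaleR borel_measurable_indicator) auto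
  then show ?thesis
    by (simp add: p(1) set_integrable_def)
qed

text \<open>The summand \<open>norm y\<close> absorbs the growth of the logarithmic potential at infinity.\<close>
lemma locally_integrableI:
  fixes \<phi> :: "real^'n::finite \<Rightarrow> real"
  assumes n: "CARD('n) \<ge> 2" and [measurable]: "\<phi> \<in> borel_measurable borel"
    and C: "C \<ge> 0" and bound: "\<And>y. \<bar>\<phi> y\<bar> \<le> C * (inverse (norm y) ^ (CARD('n) - 1) + norm y + 1)"
  shows "locally_integrable \<phi>"
  unfolding locally_integrable_def
proof (intro conjI allI)
  fix R :: real
  let ?k = "\<lambda>y::real^'n. inverse (norm y) ^ (CARD('n) - 1)"
  show "set_integrable lborel (cball 0 R) \<phi>"
    unfolding set_integrable_def
  proof (rule Bochner_Integration.integrable_bound)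
    show "integrable lborel (\<lambda>y. C * (indicator (cball 0 1) y * ?k y + (\<bar>R\<bar> + 2) * indicator (cball 0 R) y))"
      using set_integrable_inverse_norm_power[OF n] unfolding set_integrable_def real_scaleR_def
      by (intro integrable_mult_right Bochner_Integration.integrable_add integrable_real_indicator)
        (use emeasure_lborel_cball_finite in simp_all)
    show "AE y in lborel. norm (indicator (cball 0 R) y *\<^sub>R \<phi> y)
        \<le> norm (C * (indicator (cball 0 1) y * ?k y + (\<bar>R\<bar> + 2) * indicator (cball 0 R) y))"
    proof (intro AE_I2)
      fix y :: "real^'n"
      have "?k y \<le> indicator (cball 0 1) y * ?k y + 1"
      proof (cases "norm y \<le> 1")
        case False
        then have "?k y \<le> 1 ^ (CARD('n) - 1)" by (intro power_mono) (auto intro: inverse_le_1_iff[THEN iffD2])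
        then show ?thesis by (simp add: indicator_def)
      qed (auto simp: indicator_def)
      then have "norm y \<le> R \<Longrightarrow> ?k y + norm y + 1 \<le> indicator (cball 0 1) y * ?k y + (\<bar>R\<bar> + 2)"
        by simp
      then have "norm y \<le> R \<Longrightarrow> \<bar>\<phi> y\<bar> \<le> C * (indicator (cball 0 1) y * ?k y + (\<bar>R\<bar> + 2))"
        using order_trans[OF bound mult_left_mono[OF _ C]] by blast
      then show "norm (indicator (cball 0 R) y *\<^sub>R \<phi> y)
        \<le> norm (C * (indicator (cball 0 1) y * ?k y + (\<bar>R\<bar> + 2) * indicator (cball 0 R) y))"
        by (auto simp: indicator_def split: if_splits)
    qed
    show "(\<lambda>y. indicator (cball 0 R) y *\<^sub>R \<phi> y) \<in> borel_measurable lborel"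
      by (intro borel_measurable_scaleR borel_measurable_indicator) auto
  qed
qed simp

section \<open>Integration by parts for locally Lipschitz functions\<close>

definition locally_lipschitz :: "('a::euclidean_space \<Rightarrow> real) \<Rightarrow> bool" where
  "locally_lipschitz \<phi> \<longleftrightarrow> (\<forall>R. \<exists>L. L-lipschitz_on (cball 0 R) \<phi>)"

lemma locally_lipschitz_continuous_on:
  assumes "locally_lipschitz \<phi>"
  shows "continuous_on S \<phi>"
proof -
  have "continuous (at x) \<phi>" for x
  proof -
    have "continuous_on (ball 0 (norm x + 1)) \<phi>"
      using assms lipschitz_on_continuous_on continuous_on_subset ball_subset_cball
      unfolding locally_lipschitz_def by metis
    then show ?thesis
      by (subst (asm) continuous_on_eq_continuous_at) auto
  qed
  then show ?thesis by (rule continuous_at_imp_continuous_on[OF ballI])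
qed

lemma locally_lipschitz_locally_integrable:
  "locally_lipschitz \<phi> \<Longrightarrow> locally_integrable \<phi>"
  unfolding locally_integrable_def set_integrable_def
  by (auto intro!: borel_measurable_continuous_onI borel_integrable_compact locally_lipschitz_continuous_on
      simp del: real_scaleR_def)

lemma locally_lipschitz_const: "locally_lipschitz (\<lambda>z. c)"
  unfolding locally_lipschitz_def using lipschitz_on_constant by blast

lemma locally_lipschitz_mult:
  assumes "locally_lipschitz f" "locally_lipschitz g"
  shows "locally_lipschitz (\<lambda>z. f z * g z)"
  unfolding locally_lipschitz_def
proof
  fix R :: real
  obtain K L where KL: "K-lipschitz_on (cball 0 R) f" "L-lipschitz_on (cball 0 R) g"
    using assms unfolding locally_lipschitz_def by metis
  have "\<exists>B>0. \<forall>z\<in>cball 0 R. \<bar>h z\<bar> \<le> B" if "locally_lipschitz h" for h :: "'a \<Rightarrow> real"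
    using compact_imp_bounded[OF compact_continuous_image[OF locally_lipschitz_continuous_on[OF that] compact_cball]]
    by (auto simp: bounded_pos)
  then obtain B C where BC: "B > 0" "C > 0" "\<And>z. z \<in> cball 0 R \<Longrightarrow> \<bar>f z\<bar> \<le> B" "\<And>z. z \<in> cball 0 R \<Longrightarrow> \<bar>g z\<bar> \<le> C"
    using assms by metis
  have "(B * L + C * K)-lipschitz_on (cball 0 R) (\<lambda>z. f z * g z)"
  proof (rule lipschitz_onI)
    fix y z :: 'a assume yz: "y \<in> cball 0 R" "z \<in> cball 0 R"
    have "f y * g y - f z * g z = f y * (g y - g z) + g z * (f y - f z)" by (simp add: algebra_simps)
    then have "\<bar>f y * g y - f z * g z\<bar> \<le> \<bar>f y\<bar> * \<bar>g y - g z\<bar> + \<bar>g z\<bar> * \<bar>f y - f z\<bar>"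
      by (metis abs_mult abs_triangle_ineq)
    also have "\<dots> \<le> B * (L * dist y z) + C * (K * dist y z)"
      using lipschitz_onD[OF KL(1) yz] lipschitz_onD[OF KL(2) yz] BC yz
      by (intro add_mono mult_mono) (auto simp: dist_real_def)
    finally show "dist (f y * g y) (f z * g z) \<le> (B * L + C * K) * dist y z"
      by (simp add: dist_real_def algebra_simps)
  qed (use BC KL[THEN lipschitz_on_nonneg] in auto)
  then show "\<exists>L. L-lipschitz_on (cball 0 R) (\<lambda>z. f z * g z)" ..
qed

lemma locally_lipschitz_power:
  "locally_lipschitz f \<Longrightarrow> locally_lipschitz (\<lambda>z. f z ^ k)"
  by (induction k) (auto intro: locally_lipschitz_mult locally_lipschitz_const)

lemma locally_lipschitzI:
  assumes "L \<ge> 0" "\<And>y z. \<bar>\<phi> y - \<phi> z\<bar> \<le> L * norm (y - z)"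
  shows "locally_lipschitz \<phi>"
  unfolding locally_lipschitz_def using assms
  by (auto simp: lipschitz_on_def dist_norm intro!: exI[of _ L])

lemma difference_quotient_tendsto:
  fixes f :: "'a::real_normed_vector \<Rightarrow> 'b::real_normed_vector"
  assumes "(f has_derivative D) (at z)" and t: "t \<longlonglongrightarrow> 0" "\<And>k. t k > 0" and "v \<noteq> 0"
  shows "(\<lambda>k. (1 / t k) *\<^sub>R (f (z + t k *\<^sub>R v) - f z)) \<longlonglongrightarrow> D v"
proof -
  have lin: "bounded_linear D" using assms(1) by (rule has_derivative_bounded_linear)
  have lim: "((\<lambda>h. norm (f (z + h) - f z - D h) / norm h) \<longlongrightarrow> 0) (at 0)"
    using assms(1) by (simp add: has_derivative_at)
  have "filterlim (\<lambda>k. t k *\<^sub>R v) (at 0) sequentially"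
  proof (rule filterlim_atI)
    show "(\<lambda>k. t k *\<^sub>R v) \<longlonglongrightarrow> 0" using tendsto_scaleR[OF t(1) tendsto_const[of v]] by simp
    show "\<forall>\<^sub>F k in sequentially. t k *\<^sub>R v \<noteq> 0"
      using t(2) \<open>v \<noteq> 0\<close> by (auto intro!: always_eventually simp: less_le)
  qed
  then have "(\<lambda>k. norm (f (z + t k *\<^sub>R v) - f z - D (t k *\<^sub>R v)) / norm (t k *\<^sub>R v)) \<longlonglongrightarrow> 0"
    by (rule filterlim_compose[OF lim])
  then have "(\<lambda>k. norm (f (z + t k *\<^sub>R v) - f z - D (t k *\<^sub>R v)) / norm (t k *\<^sub>R v) * norm v) \<longlonglongrightarrow> 0"
    by (rule tendsto_mult_left_zero)
  moreover have "norm (f (z + t k *\<^sub>R v) - f z - D (t k *\<^sub>R v)) / norm (t k *\<^sub>R v) * norm v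
      = norm ((1 / t k) *\<^sub>R (f (z + t k *\<^sub>R v) - f z) - D v)" for k
  proof -
    have "(1 / t k) *\<^sub>R (f (z + t k *\<^sub>R v) - f z) - D v
        = (1 / t k) *\<^sub>R (f (z + t k *\<^sub>R v) - f z - D (t k *\<^sub>R v))"
      using t(2)[of k] by (simp add: linear_scale[OF bounded_linear.linear[OF lin]] scaleR_diff_right)
    then show ?thesis using t(2)[of k] \<open>v \<noteq> 0\<close> by simp
  qed
  ultimately show ?thesis
    by (simp add: tendsto_norm_zero_iff LIM_zero_iff[of _ "D v"])
qed

text \<open>Translation invariance gives the identity for difference quotients:
  \<open>\<integral> (\<phi>(z + t v) - \<phi>(z)) f(x - z) dz = \<integral> \<phi>(z) (f(x - z + t v) - f(x - z)) dz\<close>. The Lipschitz bounds on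
  \<open>\<phi>\<close> and \<open>f\<close> dominate both sides after division by \<open>t\<close>, so \<open>t \<rightarrow> 0\<close> is allowed. There is no sign
  because \<open>f\<close> is evaluated at \<open>x - z\<close>. Differentiability of \<open>\<phi>\<close> is needed almost everywhere only,
  which admits the kink of the truncated kernels along a sphere.\<close>
lemma integration_by_parts:
  fixes f :: "real^'n::finite \<Rightarrow> 'b::{banach, second_countable_topology}"
  assumes \<phi>: "locally_lipschitz \<phi>" and f: "test_fun f"
    and [measurable]: "\<phi>' \<in> borel_measurable borel"
    and deriv: "AE z in lborel. \<exists>D. (\<phi> has_derivative D) (at z) \<and> D (axis i 1) = \<phi>' z"
  shows "(\<integral>z. \<phi> z *\<^sub>R partial i f (x - z) \<partial>lborel) = (\<integral>z. \<phi>' z *\<^sub>R f (x - z) \<partial>lborel)"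
proof -
  define v where "v = (axis i 1 :: real^'n)"
  have v: "norm v = 1" "v \<noteq> 0" by (auto simp: v_def)
  define t where "t = (\<lambda>k. inverse (real (Suc k)))"
  have t: "t k > 0" "t k \<le> 1" for k by (auto simp: t_def inverse_le_1_iff)
  have t0: "t \<longlonglongrightarrow> 0" unfolding t_def by (rule LIMSEQ_inverse_real_of_nat)
  note \<phi>i = locally_lipschitz_locally_integrable[OF \<phi>]
  have m [measurable]: "\<phi> \<in> borel_measurable borel" "\<And>x. (\<lambda>z. f (x - z)) \<in> borel_measurable borel"
      "(\<lambda>z. partial i f (x - z)) \<in> borel_measurable borel"
    using \<phi>i f by (auto intro: locally_integrable_measurable measurable_reflect test_fun_partial)
  obtain R where R: "R > 0" "\<And>z. norm z > R \<Longrightarrow> f (x - z) = 0"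
    using test_fun_reflect[OF f] by blast
  obtain B where B: "B > 0" "\<And>x. norm (f x) \<le> B"
    using test_fun_bounded[OF f] by blast
  obtain Lf where Lf: "Lf-lipschitz_on UNIV f" using test_fun_lipschitz[OF f] by blast
  obtain L where L: "L-lipschitz_on (cball 0 (R + 1)) \<phi>"
    using \<phi> by (auto simp: locally_lipschitz_def)
  have shift: "norm (z + t k *\<^sub>R v) \<le> norm z + 1" "norm z \<le> norm (z - t k *\<^sub>R v) + 1" for z k
    using norm_triangle_ineq[of z "t k *\<^sub>R v"] norm_triangle_ineq2[of z "t k *\<^sub>R v"] t[of k] v(1) by auto
  define lhs where "lhs k z = ((1 / t k) *\<^sub>R (\<phi> (z + t k *\<^sub>R v) - \<phi> z)) *\<^sub>R f (x - z)" for k z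
  define rhs where "rhs k z = \<phi> z *\<^sub>R ((1 / t k) *\<^sub>R (f (x - z + t k *\<^sub>R v) - f (x - z)))" for k z
  have eq: "integral\<^sup>L lborel (lhs k) = integral\<^sup>L lborel (rhs k)" for k
  proof -
    let ?g = "\<lambda>z. \<phi> z *\<^sub>R f ((x + t k *\<^sub>R v) - z)"
    have mg: "?g \<in> borel_measurable borel" by measurable
    have g: "integrable lborel ?g" by (rule convolution_integrable[OF \<phi>i f])
    have sh: "?g (t k *\<^sub>R v + z) = \<phi> (z + t k *\<^sub>R v) *\<^sub>R f (x - z)" for z
      by (simp add: algebra_simps)
    have i1: "integrable lborel (\<lambda>z. \<phi> (z + t k *\<^sub>R v) *\<^sub>R f (x - z))"
      using g integrable_lborel_translate[OF mg, of "t k *\<^sub>R v"] unfolding sh by simp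
    have e1: "(\<integral>z. \<phi> (z + t k *\<^sub>R v) *\<^sub>R f (x - z) \<partial>lborel) = integral\<^sup>L lborel ?g"
      using integral_lborel_translate[OF mg, of "t k *\<^sub>R v"] unfolding sh by simp
    have i2: "integrable lborel (\<lambda>z. \<phi> z *\<^sub>R f (x - z))"
      by (rule convolution_integrable[OF \<phi>i f])
    have "lhs k = (\<lambda>z. (1 / t k) *\<^sub>R (\<phi> (z + t k *\<^sub>R v) *\<^sub>R f (x - z) - \<phi> z *\<^sub>R f (x - z)))"
      by (simp add: lhs_def fun_eq_iff scaleR_diff_left scaleR_diff_right diff_divide_distrib)
    then have "integral\<^sup>L lborel (lhs k) =
        (1 / t k) *\<^sub>R (integral\<^sup>L lborel ?g - (\<integral>z. \<phi> z *\<^sub>R f (x - z) \<partial>lborel))"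
      using i1 i2 e1 by simp
    moreover have "rhs k = (\<lambda>z. (1 / t k) *\<^sub>R (?g z - \<phi> z *\<^sub>R f (x - z)))"
      by (simp add: rhs_def fun_eq_iff scaleR_diff_right add_ac diff_add_eq)
    then have "integral\<^sup>L lborel (rhs k) =
        (1 / t k) *\<^sub>R (integral\<^sup>L lborel ?g - (\<integral>z. \<phi> z *\<^sub>R f (x - z) \<partial>lborel))"
      using g i2 by simp
    ultimately show ?thesis by simp
  qed
  have "(\<lambda>k. integral\<^sup>L lborel (lhs k)) \<longlonglongrightarrow> (\<integral>z. \<phi>' z *\<^sub>R f (x - z) \<partial>lborel)"
  proof (rule integral_dominated_convergence)
    show "(\<lambda>z. \<phi>' z *\<^sub>R f (x - z)) \<in> borel_measurable lborel" by measurable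
    show "lhs k \<in> borel_measurable lborel" for k unfolding lhs_def by measurable
    show "integrable lborel (\<lambda>z. L * B * indicator (cball 0 R) z)"
      by (intro integrable_mult_right integrable_real_indicator)
        (use emeasure_lborel_cball_finite in simp_all)
    show "AE z in lborel. (\<lambda>k. lhs k z) \<longlonglongrightarrow> \<phi>' z *\<^sub>R f (x - z)"
      using deriv
    proof eventually_elim
      case (elim z)
      then obtain D where D: "(\<phi> has_derivative D) (at z)" "D v = \<phi>' z" by (auto simp: v_def)
      show ?case
        unfolding lhs_def D(2)[symmetric]
        by (intro tendsto_intros difference_quotient_tendsto D t0 t v)
    qed
    show "AE z in lborel. norm (lhs k z) \<le> L * B * indicator (cball 0 R) z" for k
    proof (intro AE_I2)
      fix z
      show "norm (lhs k z) \<le> L * B * indicator (cball 0 R) z"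
      proof (cases "norm z \<le> R")
        case True
        have "\<bar>\<phi> (z + t k *\<^sub>R v) - \<phi> z\<bar> \<le> L * t k"
          using lipschitz_on_normD[OF L, of "z + t k *\<^sub>R v" z] True shift(1)[of z k] v t[of k] by simp
        then have "1 / t k * \<bar>\<phi> (z + t k *\<^sub>R v) - \<phi> z\<bar> \<le> L"
          using t[of k] by (simp add: field_simps)
        then have "1 / t k * \<bar>\<phi> (z + t k *\<^sub>R v) - \<phi> z\<bar> * norm (f (x - z)) \<le> L * B"
          using B lipschitz_on_nonneg[OF L] by (intro mult_mono) auto
        then show ?thesis
          unfolding lhs_def using True t[of k] by simp
      qed (use R in \<open>simp add: lhs_def\<close>)
    qed
  qed
  moreover have "(\<lambda>k. integral\<^sup>L lborel (rhs k)) \<longlonglongrightarrow> (\<integral>z. \<phi> z *\<^sub>R partial i f (x - z) \<partial>lborel)"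
  proof (rule integral_dominated_convergence)
    show "(\<lambda>z. \<phi> z *\<^sub>R partial i f (x - z)) \<in> borel_measurable lborel" by measurable
    have [measurable]: "(\<lambda>z. f (x - z + t k *\<^sub>R v)) \<in> borel_measurable borel" for k
      using m(2)[of "x + t k *\<^sub>R v"] by (simp add: algebra_simps)
    show "rhs k \<in> borel_measurable lborel" for k unfolding rhs_def by measurable
    show "integrable lborel (\<lambda>z. Lf * norm (indicator (cball 0 (R + 1)) z *\<^sub>R \<phi> z))"
      using \<phi>i unfolding locally_integrable_def set_integrable_def
      by (intro integrable_mult_right integrable_norm) blast
    show "AE z in lborel. (\<lambda>k. rhs k z) \<longlonglongrightarrow> \<phi> z *\<^sub>R partial i f (x - z)"
    proof (intro AE_I2)
      fix z
      have "(\<Sum>j\<in>UNIV. v $ j *\<^sub>R partial j f (x - z)) = partial i f (x - z)"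
        by (simp add: v_def axis_def if_distrib[of "\<lambda>t. t *\<^sub>R _"] cong: if_cong)
      then show "(\<lambda>k. rhs k z) \<longlonglongrightarrow> \<phi> z *\<^sub>R partial i f (x - z)"
        using difference_quotient_tendsto[OF test_fun_has_derivative[OF f, of "x - z" UNIV] t0 t(1) v(2)]
        unfolding rhs_def by (intro tendsto_intros) simp
    qed
    show "AE z in lborel. norm (rhs k z) \<le> Lf * norm (indicator (cball 0 (R + 1)) z *\<^sub>R \<phi> z)" for k
    proof (intro AE_I2)
      fix z
      show "norm (rhs k z) \<le> Lf * norm (indicator (cball 0 (R + 1)) z *\<^sub>R \<phi> z)"
      proof (cases "norm z \<le> R + 1")
        case True
        have "norm (f (x - z + t k *\<^sub>R v) - f (x - z)) \<le> Lf * t k"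
          using lipschitz_on_normD[OF Lf, of "x - z + t k *\<^sub>R v" "x - z"] v t[of k] by simp
        then have "1 / t k * norm (f (x - z + t k *\<^sub>R v) - f (x - z)) \<le> Lf"
          using t[of k] by (simp add: field_simps)
        then have "\<bar>\<phi> z\<bar> * (1 / t k * norm (f (x - z + t k *\<^sub>R v) - f (x - z))) \<le> \<bar>\<phi> z\<bar> * Lf"
          by (rule mult_left_mono) simp
        then show ?thesis
          unfolding rhs_def using True t[of k] by (simp add: mult.commute)
      next
        case False
        then have "f (x - z) = 0" "f (x - (z - t k *\<^sub>R v)) = 0"
          using R shift(2)[of z k] by auto
        then show ?thesis using False by (simp add: rhs_def diff_diff_eq2 diff_add_eq)
      qed
    qed
  qed
  ultimately show ?thesis
    unfolding eq by (rule LIMSEQ_unique[OF _ _, symmetric])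
qed

section \<open>The kernels and their truncations\<close>

text \<open>Up to the factor \<open>1 / (n \<omega>\<^sub>n)\<close>, the \<open>i\<close>-th partial derivative of the fundamental solution with
  pole at the origin. The value at the origin is \<open>0\<close> since \<open>inverse 0 = 0\<close>.\<close>

definition coulomb_kernel :: "'n::finite \<Rightarrow> real^'n \<Rightarrow> real" where
  "coulomb_kernel i z = z $ i * inverse (norm z) ^ CARD('n)"

definition radial_potential :: "'n::finite itself \<Rightarrow> real \<Rightarrow> real" where
  "radial_potential _ r =
     (if CARD('n) = 2 then 1 / (2 * pi) * ln r
      else 1 / (real CARD('n) * (2 - real CARD('n)) * unit_ball_volume TYPE('n)) * inverse r ^ (CARD('n) - 2))"

lemma unit_ball_volume_eq: "unit_ball_volume TYPE('n::finite) = unit_ball_vol CARD('n)"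
  using content_ball[of 1 "0 :: real^'n"] by (simp add: unit_ball_volume_def)

lemma unit_ball_volume_pos: "unit_ball_volume TYPE('n::finite) > 0"
  by (simp add: unit_ball_volume_eq)

lemma measure_ball_eq:
  "r \<ge> 0 \<Longrightarrow> measure lborel (ball (0 :: real^'n::finite) r) = unit_ball_volume TYPE('n) * r ^ CARD('n)"
  using content_ball[of r "0 :: real^'n"] by (simp add: unit_ball_volume_eq)

text \<open>The equation includes the diagonal \<open>x = y\<close>: both sides follow the conventions \<open>ln 0 = 0\<close> and
  \<open>inverse 0 = 0\<close>.\<close>
lemma fundamental_solution_eq:
  assumes n: "CARD('n::finite) \<ge> 2"
  shows "fundamental_solution (x :: real^'n) y = radial_potential TYPE('n) (norm (x - y))"
proof -
  have *: "r powi (2 - int CARD('n)) = inverse r ^ (CARD('n) - 2)" for r :: real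
  proof -
    have "r powi (2 - int CARD('n)) = r powi (- int (CARD('n) - 2))"
      using n by (simp add: of_nat_diff)
    then show ?thesis by (simp add: power_int_minus power_inverse)
  qed
  show ?thesis by (simp only: fundamental_solution_def radial_potential_def *)
qed

lemma abs_coulomb_kernel_le:
  assumes n: "CARD('n::finite) \<ge> 2"
  shows "\<bar>coulomb_kernel i (z :: real^'n)\<bar> \<le> inverse (norm z) ^ (CARD('n) - 1)"
proof (cases "z = 0")
  case True
  then show ?thesis using n by (simp add: coulomb_kernel_def)
next
  case False
  obtain p where p: "CARD('n) = Suc p" using n by (cases "CARD('n)") auto
  have "\<bar>coulomb_kernel i z\<bar> \<le> norm z * inverse (norm z) ^ CARD('n)"
    unfolding coulomb_kernel_def abs_mult
    by (intro mult_mono component_le_norm_cart) auto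
  also have "\<dots> = inverse (norm z) ^ (CARD('n) - 1)"
    using False by (simp add: p)
  finally show ?thesis .
qed

lemma locally_integrable_coulomb_kernel:
  assumes n: "CARD('n::finite) \<ge> 2"
  shows "locally_integrable (coulomb_kernel i :: real^'n \<Rightarrow> real)"
proof (rule locally_integrableI[OF n])
  show "(coulomb_kernel i :: real^'n \<Rightarrow> real) \<in> borel_measurable borel"
    unfolding coulomb_kernel_def
    by (intro borel_measurable_times borel_measurable_power borel_measurable_inverse
        borel_measurable_continuous_onI continuous_intros)
  show "\<bar>coulomb_kernel i y\<bar> \<le> 1 * (inverse (norm y) ^ (CARD('n) - 1) + norm y + 1)" for y :: "real^'n"
    using abs_coulomb_kernel_le[OF n, of i y] by (simp add: add_nonneg_nonneg add.assoc add_increasing2)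
qed simp

lemma locally_integrable_radial_potential:
  assumes n: "CARD('n::finite) \<ge> 2"
  shows "locally_integrable (\<lambda>z :: real^'n. radial_potential TYPE('n) (norm z))"
proof (cases "CARD('n) = 2")
  case True
  have eq: "(\<lambda>z :: real^'n. radial_potential TYPE('n) (norm z)) = (\<lambda>z. 1 / (2 * pi) * ln (norm z))"
    using True by (simp add: radial_potential_def)
  show ?thesis
    unfolding eq
  proof (rule locally_integrableI[OF n])
    show "\<bar>1 / (2 * pi) * ln (norm z)\<bar> \<le> 1 / (2 * pi) * (inverse (norm z) ^ (CARD('n) - 1) + norm z + 1)"
      for z :: "real^'n"
    proof -
      have "\<bar>ln r\<bar> \<le> inverse r + r + 1" if "r \<ge> 0" for r :: real
      proof (cases "r = 0")
        case False
        then have "ln r \<le> r - 1" "ln (inverse r) \<le> inverse r - 1" "inverse r \<ge> 0"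
          using that by (auto intro!: ln_le_minus_one simp del: ln_inverse)
        then show ?thesis using that False unfolding ln_inverse[of r] by linarith
      qed simp
      from this[of "norm z"] show ?thesis
        using True by (simp add: abs_mult divide_right_mono)
    qed
  qed (auto intro!: borel_measurable_times borel_measurable_ln borel_measurable_continuous_onI continuous_intros)
next
  case False
  define c where "c = 1 / (real CARD('n) * (2 - real CARD('n)) * unit_ball_volume TYPE('n))"
  define p where "p = CARD('n) - 3"
  have p: "CARD('n) = Suc (Suc (Suc p))" using n False by (simp add: p_def)
  have eq: "(\<lambda>z :: real^'n. radial_potential TYPE('n) (norm z)) = (\<lambda>z. c * inverse (norm z) ^ Suc p)"
    by (rule ext) (use False in \<open>simp add: radial_potential_def c_def[symmetric], simp add: p\<close>)
  show ?thesis
    unfolding eq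
  proof (rule locally_integrableI[OF n])
    show "\<bar>c * inverse (norm z) ^ Suc p\<bar> \<le> \<bar>c\<bar> * (inverse (norm z) ^ (CARD('n) - 1) + norm z + 1)"
      for z :: "real^'n"
    proof -
      have "r ^ Suc p \<le> r ^ Suc (Suc p) + 1" if "r \<ge> 0" for r :: real
      proof (cases "r \<ge> 1")
        case True
        then show ?thesis using power_increasing[of "Suc p" "Suc (Suc p)" r] by linarith
      next
        case False
        then have "r ^ Suc p \<le> 1" using that by (intro power_le_one) auto
        moreover have "0 \<le> r ^ Suc (Suc p)" using that by simp
        ultimately show ?thesis by linarith
      qed
      from this[of "inverse (norm z)"]
      have "inverse (norm z) ^ Suc p \<le> inverse (norm z) ^ Suc (Suc p) + 1" by simp
      also have "\<dots> \<le> inverse (norm z) ^ (CARD('n) - 1) + norm z + 1" by (simp add: p)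
      finally have "inverse (norm z) ^ Suc p \<le> inverse (norm z) ^ (CARD('n) - 1) + norm z + 1" .
      then show ?thesis unfolding abs_mult by (intro mult_left_mono) auto
    qed
  qed (auto intro!: borel_measurable_times borel_measurable_power borel_measurable_inverse
        borel_measurable_continuous_onI continuous_intros)
qed

lemma locally_lipschitz_comp_max_norm:
  assumes "L \<ge> 0" "\<And>r s. e \<le> r \<Longrightarrow> r \<le> s \<Longrightarrow> \<bar>g s - g r\<bar> \<le> L * (s - r)"
  shows "locally_lipschitz (\<lambda>z :: 'a::euclidean_space. g (max (norm z) e))"
proof (rule locally_lipschitzI[OF assms(1)])
  fix y z :: 'a
  let ?r = "\<lambda>z :: 'a. max (norm z) e"
  have "\<bar>g r - g s\<bar> \<le> L * \<bar>r - s\<bar>" if "e \<le> r" "e \<le> s" for r s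
    using assms(2)[of r s] assms(2)[of s r] that by (cases "r \<le> s") (auto simp: abs_minus_commute)
  then have "\<bar>g (?r y) - g (?r z)\<bar> \<le> L * \<bar>?r y - ?r z\<bar>"
    by simp
  also have "\<bar>?r y - ?r z\<bar> \<le> norm (y - z)"
    using norm_triangle_ineq3[of y z] by (auto simp: max_def)
  finally show "\<bar>g (?r y) - g (?r z)\<bar> \<le> L * norm (y - z)"
    using assms(1) by (simp add: mult_left_mono)
qed

lemma locally_lipschitz_inverse_max_norm:
  assumes "e > 0"
  shows "locally_lipschitz (\<lambda>z :: 'a::euclidean_space. inverse (max (norm z) e))"
proof (rule locally_lipschitz_comp_max_norm)
  fix r s :: real assume rs: "e \<le> r" "r \<le> s"
  then have pos: "r > 0" "s > 0" using assms by auto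
  have "\<bar>inverse s - inverse r\<bar> = (s - r) * (inverse r * inverse s)"
    using rs pos by (simp add: field_simps)
  also have "\<dots> \<le> (s - r) * (inverse e * inverse e)"
    using rs assms by (intro mult_left_mono mult_mono le_imp_inverse_le) auto
  finally show "\<bar>inverse s - inverse r\<bar> \<le> inverse e * inverse e * (s - r)" by (simp add: mult.commute)
qed simp

lemma locally_lipschitz_ln_max_norm:
  assumes "e > 0"
  shows "locally_lipschitz (\<lambda>z :: 'a::euclidean_space. ln (max (norm z) e))"
proof (rule locally_lipschitz_comp_max_norm)
  fix r s :: real assume rs: "e \<le> r" "r \<le> s"
  then have pos: "r > 0" "s > 0" using assms by auto
  have "\<bar>ln s - ln r\<bar> = ln (s / r)"
    using rs pos by (simp add: ln_div)
  also have "\<dots> \<le> s / r - 1" using pos by (intro ln_le_minus_one) simp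
  also have "\<dots> = (s - r) * inverse r" using pos by (simp add: field_simps)
  also have "\<dots> \<le> (s - r) * inverse e"
    using rs assms by (intro mult_left_mono le_imp_inverse_le) auto
  finally show "\<bar>ln s - ln r\<bar> \<le> inverse e * (s - r)" by (simp add: mult.commute)
qed (use assms in simp)

lemma locally_lipschitz_radial_potential:
  assumes "e > 0"
  shows "locally_lipschitz (\<lambda>z :: real^'n::finite. radial_potential TYPE('n) (max (norm z) e))"
proof -
  have "locally_lipschitz (\<lambda>z :: real^'n. if b then c * ln (max (norm z) e) else d * inverse (max (norm z) e) ^ k)"
    for b c d k
    by (cases b) (simp_all add: assms locally_lipschitz_mult locally_lipschitz_const locally_lipschitz_ln_max_norm
      locally_lipschitz_power locally_lipschitz_inverse_max_norm)
  then show ?thesis unfolding radial_potential_def .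
qed

lemma locally_lipschitz_nth: "locally_lipschitz (\<lambda>z :: real^'n::finite. z $ i)"
  by (rule locally_lipschitzI[of 1])
    (use component_le_norm_cart in \<open>auto simp flip: vector_minus_component\<close>)

lemma AE_norm_neq: "AE z in lborel. norm (z :: 'a::euclidean_space) \<noteq> r"
proof -
  have "sphere (0::'a) r \<in> null_sets lborel"
    using negligible_sphere[of "0::'a" r]
    by (auto simp: null_sets_completion_iff negligible_iff_null_sets negligible_convex_frontier)
  from AE_not_in[OF this] show ?thesis by simp
qed

lemma has_derivative_radial:
  fixes z :: "real^'n::finite"
  assumes "z \<noteq> 0" "(g has_real_derivative d) (at (norm z))"
  shows "((\<lambda>z. g (norm z)) has_derivative (\<lambda>h. d * (h \<bullet> sgn z))) (at z)"
  using has_derivative_compose[OF has_derivative_norm[OF assms(1)] assms(2)[unfolded has_field_derivative_def]]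
  by simp

lemma axis_inner_sgn: "axis i 1 \<bullet> sgn (z :: real^'n::finite) = z $ i * inverse (norm z)"
  by (simp add: inner_axis' sgn_vec_def sgn_div_norm mult.commute)

lemma has_derivative_max_norm_inside:
  fixes z :: "'a::euclidean_space"
  assumes "norm z < e" "((\<lambda>z. g z e) has_derivative D) (at z)"
  shows "((\<lambda>z. g z (max (norm z) e)) has_derivative D) (at z)"
  by (rule has_derivative_transform_within_open[OF assms(2), of "ball 0 e"]) (use assms(1) in auto)

lemma has_derivative_max_norm_outside:
  fixes z :: "'a::euclidean_space"
  assumes "norm z > e" "((\<lambda>z. g z (norm z)) has_derivative D) (at z)"
  shows "((\<lambda>z. g z (max (norm z) e)) has_derivative D) (at z)"
  by (rule has_derivative_transform_within_open[OF assms(2), of "- cball 0 e"])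
    (use assms(1) in \<open>auto simp: open_Compl max_def\<close>)

text \<open>The normalization of the fundamental solution enters here: in every dimension, the logarithmic
  case included because \<open>2 \<omega>\<^sub>2 = 2 \<pi>\<close>, the radial derivative is the reciprocal of the area
  \<open>n \<omega>\<^sub>n r\<^sup>n\<^sup>-\<^sup>1\<close> of the sphere of radius \<open>r\<close>.\<close>
lemma radial_potential_has_derivative:
  assumes n: "CARD('n::finite) \<ge> 2" and "r > 0"
  shows "(radial_potential TYPE('n) has_real_derivative
    inverse r ^ (CARD('n) - 1) / (real CARD('n) * unit_ball_volume TYPE('n))) (at r)"
proof (cases "CARD('n) = 2")
  case True
  have w: "unit_ball_volume TYPE('n) = pi" by (simp add: unit_ball_volume_eq True unit_ball_vol_2)
  have eq: "radial_potential TYPE('n) = (\<lambda>r. 1 / (2 * pi) * ln r)"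
    by (rule ext) (simp add: radial_potential_def True)
  have val: "inverse r ^ (CARD('n) - 1) / (real CARD('n) * unit_ball_volume TYPE('n)) = 1 / (2 * pi) * (1 / r)"
    unfolding w True by (simp add: inverse_eq_divide)
  show ?thesis
    unfolding eq val by (rule DERIV_cmult[OF DERIV_ln_divide[OF \<open>r > 0\<close>]])
next
  case False
  define p where "p = CARD('n) - 3"
  have p: "CARD('n) = Suc (Suc (Suc p))" using n False by (simp add: p_def)
  define w where "w = unit_ball_volume TYPE('n)"
  define k where "k = real (Suc p)"
  define m where "m = real CARD('n)"
  have pos: "w > 0" "k > 0" "m > 0" by (simp_all add: w_def unit_ball_volume_pos k_def m_def)
  have k: "2 - m = - k" by (simp add: p k_def m_def)
  have eq: "radial_potential TYPE('n) = (\<lambda>r. 1 / (m * - k * w) * inverse r ^ Suc p)"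
    by (rule ext) (use False in \<open>simp add: radial_potential_def k flip: w_def m_def, simp add: p\<close>)
  have "((\<lambda>r. inverse r ^ Suc p) has_real_derivative k * (- (inverse r ^ Suc (Suc 0)) * inverse r ^ p)) (at r)"
    using DERIV_power[OF DERIV_inverse, of r "Suc p"] \<open>r > 0\<close> by (simp add: k_def)
  from DERIV_cmult[OF this, of "1 / (m * - k * w)"]
  have "(radial_potential TYPE('n) has_real_derivative
    1 / (m * - k * w) * (k * (- (inverse r ^ Suc (Suc 0)) * inverse r ^ p))) (at r)"
    unfolding eq .
  moreover have "1 / (m * - k * w) * (k * (- (inverse r ^ Suc (Suc 0)) * inverse r ^ p))
      = inverse r ^ (CARD('n) - 1) / (m * w)"
    using pos by (simp add: p)
  ultimately show ?thesis
    by (simp only: m_def w_def)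
qed

lemma radial_potential_max_norm_deriv:
  assumes n: "CARD('n::finite) \<ge> 2" and e: "e > 0" and z: "norm (z :: real^'n) \<noteq> e"
  shows "\<exists>D. ((\<lambda>z. radial_potential TYPE('n) (max (norm z) e)) has_derivative D) (at z) \<and>
    D (axis i 1) = (if norm z < e then 0 else coulomb_kernel i z / (real CARD('n) * unit_ball_volume TYPE('n)))"
proof (cases "norm z < e")
  case True
  then show ?thesis
    by (intro exI[of _ "\<lambda>h. 0"] conjI has_derivative_max_norm_inside[where g = "\<lambda>z. radial_potential TYPE('n)"]) auto
next
  case False
  then have z: "norm z > e" "z \<noteq> 0" using z e by auto
  obtain p where p: "CARD('n) = Suc p" using n by (cases "CARD('n)") auto
  have "norm z > 0" using z by simp
  note D = has_derivative_max_norm_outside[OF z(1), where g = "\<lambda>z. radial_potential TYPE('n)",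
      OF has_derivative_radial[OF z(2) radial_potential_has_derivative[OF n this]]]
  show ?thesis
    by (rule exI, rule conjI[OF D]) (use False in \<open>simp add: axis_inner_sgn coulomb_kernel_def p\<close>)
qed

text \<open>The \<open>i\<close>-th diagonal entry of the Jacobian matrix of \<open>z \<mapsto> (max |z| e)\<^sup>-\<^sup>n z\<close> off the sphere
  \<open>|z| = e\<close>.\<close>
definition coulomb_deriv :: "real \<Rightarrow> 'n::finite \<Rightarrow> real^'n \<Rightarrow> real" where
  "coulomb_deriv e i z = (if norm z < e then inverse e ^ CARD('n)
     else inverse (norm z) ^ CARD('n) - real CARD('n) * (z $ i)\<^sup>2 * inverse (norm z) ^ (CARD('n) + 2))"

text \<open>The field \<open>|z|\<^sup>-\<^sup>n z\<close> is divergence-free away from the origin, and the truncated field is linear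
  inside the ball.\<close>
lemma sum_coulomb_deriv:
  fixes z :: "real^'n::finite"
  assumes "e > 0"
  shows "(\<Sum>i\<in>UNIV. coulomb_deriv e i z) = real CARD('n) * inverse e ^ CARD('n) * indicator (ball 0 e) z"
proof (cases "norm z < e")
  case False
  define q where "q = inverse (norm z)"
  have sq: "(\<Sum>i\<in>UNIV. (z $ i)\<^sup>2) = (norm z)\<^sup>2"
    by (simp add: norm_vec_def L2_set_def sum_nonneg)
  have "norm z \<noteq> 0" using False assms by auto
  then have q: "(norm z)\<^sup>2 * q ^ (CARD('n) + 2) = q ^ CARD('n)"
    by (simp add: q_def power2_eq_square field_simps)
  have "(\<Sum>i\<in>UNIV. coulomb_deriv e i z) =
      (\<Sum>i\<in>(UNIV::'n set). q ^ CARD('n)) - real CARD('n) * ((\<Sum>i\<in>UNIV. (z $ i)\<^sup>2) * q ^ (CARD('n) + 2))"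
    using False
    by (simp add: coulomb_deriv_def sum_subtractf sum_distrib_left sum_distrib_right mult.assoc flip: q_def)
  also have "\<dots> = 0" unfolding sq q by simp
  finally show ?thesis using False by simp
qed (simp add: coulomb_deriv_def)

lemma coulomb_max_norm_deriv:
  assumes n: "CARD('n::finite) \<ge> 2" and e: "e > 0" and z: "norm (z :: real^'n) \<noteq> e"
  shows "\<exists>D. ((\<lambda>z. z $ i * inverse (max (norm z) e) ^ CARD('n)) has_derivative D) (at z) \<and>
    D (axis i 1) = coulomb_deriv e i z"
proof -
  have nth: "((\<lambda>z. z $ i) has_derivative (\<lambda>h. h $ i)) (at z)"
    by (rule bounded_linear_imp_has_derivative[OF bounded_linear_vec_nth])
  show ?thesis
  proof (cases "norm z < e")
    case True
    have "((\<lambda>z. z $ i * inverse e ^ CARD('n)) has_derivative (\<lambda>h. h $ i * inverse e ^ CARD('n))) (at z)"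
      by (intro has_derivative_mult_left nth)
    from has_derivative_max_norm_inside[OF True, where g = "\<lambda>z r. z $ i * inverse r ^ CARD('n)", OF this] True
    show ?thesis by (auto simp: coulomb_deriv_def)
  next
    case False
    then have z: "norm z > e" "z \<noteq> 0" using z e by auto
    obtain p where p: "CARD('n) = Suc p" using n by (cases "CARD('n)") auto
    have "((\<lambda>r. inverse r ^ CARD('n)) has_real_derivative - (real CARD('n) * inverse (norm z) ^ (CARD('n) + 1)))
        (at (norm z))"
      using DERIV_power[OF DERIV_inverse, of "norm z" "CARD('n)"] z(2) by (simp add: p mult_ac)
    from has_derivative_mult[OF nth has_derivative_radial[OF z(2) this]]
    have "((\<lambda>z. z $ i * inverse (norm z) ^ CARD('n)) has_derivative
       (\<lambda>h. z $ i * (- (real CARD('n) * inverse (norm z) ^ (CARD('n) + 1)) * (h \<bullet> sgn z))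
          + h $ i * inverse (norm z) ^ CARD('n))) (at z)" .
    note D = has_derivative_max_norm_outside[OF z(1), where g = "\<lambda>z r. z $ i * inverse r ^ CARD('n)", OF this]
    show ?thesis
      by (rule exI, rule conjI[OF D])
        (use False in \<open>simp add: coulomb_deriv_def axis_inner_sgn power2_eq_square\<close>)
  qed
qed

section \<open>Removing the truncation\<close>

text \<open>Radii below \<open>1\<close>, because truncation decreases \<open>|ln r|\<close> only there.\<close>

lemma regularization_radii:
  obtains e :: "nat \<Rightarrow> real" where "\<And>k. e k > 0" "\<And>k. e k < 1" "e \<longlonglongrightarrow> 0"
proof
  show "(\<lambda>k. inverse (real (Suc (Suc k)))) \<longlonglongrightarrow> 0"
    by (rule LIMSEQ_Suc[OF LIMSEQ_inverse_real_of_nat])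
  show "inverse (real (Suc (Suc k))) < 1" for k
    by (simp add: inverse_eq_divide)
qed simp

lemma eventually_regularization_outside:
  assumes "e \<longlonglongrightarrow> 0" "(z :: 'a::euclidean_space) \<noteq> 0"
  shows "\<forall>\<^sub>F k in sequentially. e k < norm z"
  using order_tendstoD(2)[OF assms(1), of "norm z"] assms(2) by simp

lemma abs_radial_potential_max_le:
  fixes z :: "real^'n::finite"
  assumes "0 < e" "e < 1" "z \<noteq> 0"
  shows "\<bar>radial_potential TYPE('n) (max (norm z) e)\<bar> \<le> \<bar>radial_potential TYPE('n) (norm z)\<bar>"
proof (cases "norm z \<ge> e")
  case True
  then show ?thesis by (simp add: max_def)
next
  case False
  then have z: "0 < norm z" "norm z \<le> e" using assms by auto
  have "\<bar>ln e\<bar> \<le> \<bar>ln (norm z)\<bar>" using z assms ln_mono[of "norm z" e] by (simp add: abs_if)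
  moreover have "\<bar>inverse e ^ k\<bar> \<le> \<bar>inverse (norm z) ^ k\<bar>" for k
    using z assms(1) power_mono[OF le_imp_inverse_le[OF z(2,1)], of k] by (simp del: inverse_le_iff_le)
  ultimately show ?thesis
    using False by (simp add: radial_potential_def max_def abs_mult divide_right_mono mult_left_mono
       del: times_divide_eq_left times_divide_eq_right)
qed

text \<open>Integration by parts for the truncated potential, whose derivative vanishes on the ball and agrees
  with the one of the full potential outside. Both sides are dominated by the untruncated, integrable
  kernels.\<close>
lemma convolution_radial_potential_partial:
  fixes f :: "real^'n::finite \<Rightarrow> 'b::{banach, second_countable_topology}"
  assumes n: "CARD('n) \<ge> 2" and f: "test_fun f"
  shows "(\<integral>z. radial_potential TYPE('n) (norm z) *\<^sub>R partial i f (x - z) \<partial>lborel)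
    = (1 / (real CARD('n) * unit_ball_volume TYPE('n))) *\<^sub>R (\<integral>z. coulomb_kernel i z *\<^sub>R f (x - z) \<partial>lborel)"
    (is "?lhs = (1 / ?c) *\<^sub>R ?rhs")
proof -
  obtain e :: "nat \<Rightarrow> real" where e: "\<And>k. e k > 0" "\<And>k. e k < 1" "e \<longlonglongrightarrow> 0"
    using regularization_radii by blast
  note pot = locally_integrable_radial_potential[OF n] and ker = locally_integrable_coulomb_kernel[OF n, of i]
  note reg = locally_lipschitz_radial_potential[OF e(1)]
  have [measurable]: "(\<lambda>z. radial_potential TYPE('n) (norm (z::real^'n))) \<in> borel_measurable borel"
    by (rule locally_integrable_measurable[OF pot])
  have [measurable]: "coulomb_kernel i \<in> borel_measurable borel"
    by (rule locally_integrable_measurable[OF ker])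
  have [measurable]: "(\<lambda>z::real^'n. radial_potential TYPE('n) (max (norm z) (e k))) \<in> borel_measurable borel" for k
    by (rule locally_integrable_measurable[OF locally_lipschitz_locally_integrable[OF reg]])
  have [measurable]: "(\<lambda>z. f (x - z)) \<in> borel_measurable borel"
    by (rule measurable_reflect[OF f])
  have [measurable]: "(\<lambda>z. partial i f (x - z)) \<in> borel_measurable borel"
    by (rule measurable_reflect[OF test_fun_partial[OF f]])
  let ?d = "\<lambda>k z::real^'n. if norm z < e k then 0 else coulomb_kernel i z / ?c"
  have [measurable]: "?d k \<in> borel_measurable borel" for k by measurable
  have parts: "(\<integral>z. radial_potential TYPE('n) (max (norm z) (e k)) *\<^sub>R partial i f (x - z) \<partial>lborel)
      = (\<integral>z. ?d k z *\<^sub>R f (x - z) \<partial>lborel)" for k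
  proof (rule integration_by_parts[OF reg f])
    show "?d k \<in> borel_measurable borel" by measurable
    show "AE z in lborel. \<exists>D. ((\<lambda>z. radial_potential TYPE('n) (max (norm z) (e k))) has_derivative D) (at z)
        \<and> D (axis i 1) = ?d k z"
      using AE_norm_neq[of "e k"] by eventually_elim (rule radial_potential_max_norm_deriv[OF n e(1)])
  qed
  have "(\<lambda>k. \<integral>z. radial_potential TYPE('n) (max (norm z) (e k)) *\<^sub>R partial i f (x - z) \<partial>lborel) \<longlonglongrightarrow> ?lhs"
  proof (rule integral_dominated_convergence)
    show "integrable lborel (\<lambda>z. norm (radial_potential TYPE('n) (norm z) *\<^sub>R partial i f (x - z)))"
      by (intro integrable_norm convolution_integrable[OF pot] test_fun_partial f)
    show "AE z in lborel. (\<lambda>k. radial_potential TYPE('n) (max (norm z) (e k)) *\<^sub>R partial i f (x - z))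
        \<longlonglongrightarrow> radial_potential TYPE('n) (norm z) *\<^sub>R partial i f (x - z)"
      using AE_lborel_singleton[of "0::real^'n"]
    proof eventually_elim
      case (elim z)
      show ?case
        by (rule tendsto_eventually, rule eventually_mono[OF eventually_regularization_outside[OF e(3) elim]])
          (simp add: max_def)
    qed
    show "AE z in lborel. norm (radial_potential TYPE('n) (max (norm z) (e k)) *\<^sub>R partial i f (x - z))
        \<le> norm (radial_potential TYPE('n) (norm z) *\<^sub>R partial i f (x - z))" for k
      using AE_lborel_singleton[of "0::real^'n"]
      by eventually_elim (simp add: mult_right_mono abs_radial_potential_max_le[OF e(1,2)])
  qed measurable
  moreover have "(\<lambda>k. \<integral>z. ?d k z *\<^sub>R f (x - z) \<partial>lborel) \<longlonglongrightarrow> (\<integral>z. (1 / ?c) *\<^sub>R (coulomb_kernel i z *\<^sub>R f (x - z)) \<partial>lborel)"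
  proof (rule integral_dominated_convergence)
    show "integrable lborel (\<lambda>z. norm ((1 / ?c) *\<^sub>R (coulomb_kernel i z *\<^sub>R f (x - z))))"
      by (intro integrable_norm integrable_scaleR_right convolution_integrable[OF ker] f)
    show "AE z in lborel. (\<lambda>k. ?d k z *\<^sub>R f (x - z)) \<longlonglongrightarrow> (1 / ?c) *\<^sub>R (coulomb_kernel i z *\<^sub>R f (x - z))"
      using AE_lborel_singleton[of "0::real^'n"]
    proof eventually_elim
      case (elim z)
      show ?case
        by (rule tendsto_eventually, rule eventually_mono[OF eventually_regularization_outside[OF e(3) elim]])
          simp
    qed
    show "AE z in lborel. norm (?d k z *\<^sub>R f (x - z)) \<le> norm ((1 / ?c) *\<^sub>R (coulomb_kernel i z *\<^sub>R f (x - z)))" for k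
      by (rule AE_I2) (simp add: divide_inverse mult.commute)
  qed measurable
  ultimately have "?lhs = (\<integral>z. (1 / ?c) *\<^sub>R (coulomb_kernel i z *\<^sub>R f (x - z)) \<partial>lborel)"
    unfolding parts by (rule LIMSEQ_unique)
  then show ?thesis by (simp only: integral_scaleR_right)
qed

lemma norm_ball_average_le:
  fixes f :: "real^'n::finite \<Rightarrow> 'b::{banach, second_countable_topology}"
  assumes f: "test_fun f" and e: "e > 0"
    and close: "\<And>z. norm z < e \<Longrightarrow> norm (f (x - z) - f x) \<le> d"
  shows "norm (inverse e ^ CARD('n) *\<^sub>R (\<integral>z. indicator (ball 0 e) z *\<^sub>R f (x - z) \<partial>lborel)
    - unit_ball_volume TYPE('n) *\<^sub>R f x) \<le> d * unit_ball_volume TYPE('n)"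
proof -
  let ?w = "unit_ball_volume TYPE('n)" and ?B = "ball (0::real^'n) e"
  have ind: "integrable lborel (indicator ?B :: _ \<Rightarrow> real)"
    by (rule integrable_real_indicator) (use emeasure_lborel_ball_finite in simp_all)
  have vol: "(\<integral>z. indicator ?B z \<partial>lborel) = ?w * e ^ CARD('n)"
    using measure_ball_eq[where 'n = 'n, of e] e by simp
  have m [measurable]: "(\<lambda>z. f (x - z)) \<in> borel_measurable borel" by (rule measurable_reflect[OF f])
  obtain B where B: "B > 0" "\<And>x. norm (f x) \<le> B" using test_fun_bounded[OF f] by blast
  have i1: "integrable lborel (\<lambda>z. indicator ?B z *\<^sub>R f (x - z))"
  proof (rule Bochner_Integration.integrable_bound)
    show "integrable lborel (\<lambda>z. B * indicator ?B z)" using ind by simp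
    show "(\<lambda>z. indicator ?B z *\<^sub>R f (x - z)) \<in> borel_measurable lborel"
      by (intro borel_measurable_scaleR borel_measurable_indicator) auto
  qed (use B in \<open>auto simp: indicator_def\<close>)
  have i2: "integrable lborel (\<lambda>z. indicator ?B z *\<^sub>R f x)" using ind by simp
  have "(\<integral>z. indicator ?B z *\<^sub>R f (x - z) \<partial>lborel) - (?w * e ^ CARD('n)) *\<^sub>R f x
      = (\<integral>z. indicator ?B z *\<^sub>R f (x - z) - indicator ?B z *\<^sub>R f x \<partial>lborel)"
    using i1 i2 ind vol by simp
  also have "norm \<dots> \<le> (\<integral>z. d * indicator ?B z \<partial>lborel)"
  proof (rule Bochner_Integration.integral_norm_bound_integral)
    show "integrable lborel (\<lambda>z. indicator ?B z *\<^sub>R f (x - z) - indicator ?B z *\<^sub>R f x)"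
      by (rule Bochner_Integration.integrable_diff[OF i1 i2])
    show "integrable lborel (\<lambda>z. d * indicator ?B z)"
      by (rule integrable_mult_right[OF ind])
  qed (use close in \<open>auto simp: indicator_def\<close>)
  also have "\<dots> = d * (?w * e ^ CARD('n))" using vol by simp
  finally have "norm ((\<integral>z. indicator ?B z *\<^sub>R f (x - z) \<partial>lborel) - (?w * e ^ CARD('n)) *\<^sub>R f x)
      \<le> d * (?w * e ^ CARD('n))" .
  then have "inverse e ^ CARD('n) * norm ((\<integral>z. indicator ?B z *\<^sub>R f (x - z) \<partial>lborel) - (?w * e ^ CARD('n)) *\<^sub>R f x)
      \<le> inverse e ^ CARD('n) * (d * (?w * e ^ CARD('n)))"
    using e by (intro mult_left_mono) auto
  also have "inverse e ^ CARD('n) * (d * (?w * e ^ CARD('n))) = d * ?w * (inverse e * e) ^ CARD('n)"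
    by (simp only: power_mult_distrib mult_ac)
  also have "\<dots> = d * ?w" using e by simp
  also have "inverse e ^ CARD('n) * norm ((\<integral>z. indicator ?B z *\<^sub>R f (x - z) \<partial>lborel) - (?w * e ^ CARD('n)) *\<^sub>R f x)
    = norm (inverse e ^ CARD('n) *\<^sub>R ((\<integral>z. indicator ?B z *\<^sub>R f (x - z) \<partial>lborel) - (?w * e ^ CARD('n)) *\<^sub>R f x))"
    using e by simp
  also have "inverse e ^ CARD('n) *\<^sub>R ((\<integral>z. indicator ?B z *\<^sub>R f (x - z) \<partial>lborel) - (?w * e ^ CARD('n)) *\<^sub>R f x)
    = inverse e ^ CARD('n) *\<^sub>R (\<integral>z. indicator ?B z *\<^sub>R f (x - z) \<partial>lborel) - (?w * (inverse e * e) ^ CARD('n)) *\<^sub>R f x"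
    by (simp only: scaleR_diff_right scaleR_scaleR power_mult_distrib mult_ac)
  finally show ?thesis using e by simp
qed

text \<open>For the truncated field, integration by parts turns the left-hand side into \<open>n e\<^sup>-\<^sup>n\<close> times the
  integral of \<open>f\<close> over the ball of radius \<open>e\<close> around \<open>x\<close>, that is, \<open>n \<omega>\<^sub>n\<close> times the mean of \<open>f\<close> over
  this ball.\<close>
lemma sum_convolution_coulomb_partial:
  fixes f :: "real^'n::finite \<Rightarrow> 'b::{banach, second_countable_topology}"
  assumes n: "CARD('n) \<ge> 2" and f: "test_fun f"
  shows "(\<Sum>i\<in>UNIV. \<integral>z. coulomb_kernel i z *\<^sub>R partial i f (x - z) \<partial>lborel)
    = (real CARD('n) * unit_ball_volume TYPE('n)) *\<^sub>R f x"
proof -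
  obtain e :: "nat \<Rightarrow> real" where e: "\<And>k. e k > 0" "\<And>k. e k < 1" "e \<longlonglongrightarrow> 0"
    using regularization_radii by blast
  let ?w = "unit_ball_volume TYPE('n)"
  let ?K = "\<lambda>k i z::real^'n. z $ i * inverse (max (norm z) (e k)) ^ CARD('n)"
  note ker = locally_integrable_coulomb_kernel[OF n]
  have reg: "locally_lipschitz (?K k i)" for k i
    by (intro locally_lipschitz_mult locally_lipschitz_power locally_lipschitz_nth
        locally_lipschitz_inverse_max_norm e)
  have [measurable]: "coulomb_kernel i \<in> borel_measurable borel" for i :: 'n
    by (rule locally_integrable_measurable[OF ker])
  have [measurable]: "?K k i \<in> borel_measurable borel" for i k
    by (rule locally_integrable_measurable[OF locally_lipschitz_locally_integrable[OF reg]])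
  have [measurable]: "(\<lambda>z. f (x - z)) \<in> borel_measurable borel"
    by (rule measurable_reflect[OF f])
  have [measurable]: "(\<lambda>z. partial i f (x - z)) \<in> borel_measurable borel" for i
    by (rule measurable_reflect[OF test_fun_partial[OF f]])
  have cd [measurable]: "coulomb_deriv (e k) i \<in> borel_measurable borel" for k and i :: 'n
  proof -
    have [measurable]: "(\<lambda>z::real^'n. z $ i) \<in> borel_measurable borel"
      by (intro borel_measurable_continuous_onI continuous_intros)
    show ?thesis unfolding coulomb_deriv_def[abs_def] by measurable
  qed
  have parts: "(\<integral>z. ?K k i z *\<^sub>R partial i f (x - z) \<partial>lborel) = (\<integral>z. coulomb_deriv (e k) i z *\<^sub>R f (x - z) \<partial>lborel)" for k i
    by (rule integration_by_parts[OF reg f cd])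
      (rule eventually_mono[OF AE_norm_neq[of "e k"] coulomb_max_norm_deriv[OF n e(1)]])
  have cd_int: "integrable lborel (\<lambda>z. coulomb_deriv (e k) i z *\<^sub>R f (x - z))" for k i
  proof -
    define C where "C = (1 + real CARD('n)) * inverse (e k) ^ CARD('n)"
    have "\<bar>coulomb_deriv (e k) i z\<bar> \<le> C" for z
    proof (cases "norm z < e k")
      case True
      then show ?thesis using e(1)[of k] by (simp add: coulomb_deriv_def C_def distrib_right)
    next
      case False
      then have z: "norm z \<ge> e k" "norm z > 0" using e(1)[of k] by auto
      have "(z $ i)\<^sup>2 \<le> (norm z)\<^sup>2"
        using component_le_norm_cart[of z i] abs_le_square_iff[of "z $ i" "norm z"] by simp
      then have "(z $ i)\<^sup>2 * inverse (norm z) ^ (CARD('n) + 2) \<le> (norm z)\<^sup>2 * inverse (norm z) ^ (CARD('n) + 2)"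
        by (intro mult_right_mono) auto
      also have "\<dots> = inverse (norm z) ^ CARD('n)" using z by (simp add: power2_eq_square field_simps)
      finally have sq: "(z $ i)\<^sup>2 * inverse (norm z) ^ (CARD('n) + 2) \<le> inverse (norm z) ^ CARD('n)" .
      have inv: "inverse (norm z) ^ CARD('n) \<le> inverse (e k) ^ CARD('n)"
        using z e(1)[of k] by (intro power_mono le_imp_inverse_le) auto
      have "\<bar>coulomb_deriv (e k) i z\<bar> \<le> inverse (norm z) ^ CARD('n)
          + real CARD('n) * ((z $ i)\<^sup>2 * inverse (norm z) ^ (CARD('n) + 2))"
        using False abs_triangle_ineq4[of "inverse (norm z) ^ CARD('n)" "real CARD('n) * ((z $ i)\<^sup>2 * inverse (norm z) ^ (CARD('n) + 2))"]
        by (simp add: coulomb_deriv_def mult.assoc abs_mult)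
      also have "\<dots> \<le> inverse (e k) ^ CARD('n) + real CARD('n) * inverse (e k) ^ CARD('n)"
        by (intro add_mono mult_left_mono inv order_trans[OF sq inv]) simp
      finally show ?thesis by (simp add: C_def distrib_right)
    qed
    moreover have "C \<ge> 0" using e(1)[of k] by (simp add: C_def)
    ultimately have "locally_integrable (coulomb_deriv (e k) i)"
      by (intro locally_integrableI[OF n cd, of C])
        (auto intro!: order_trans[where y = "C * 1" and z = "C * (_ + _ + 1)"] mult_left_mono)
    then show ?thesis by (rule convolution_integrable[OF _ f])
  qed
  have avg: "(\<Sum>i\<in>UNIV. \<integral>z. ?K k i z *\<^sub>R partial i f (x - z) \<partial>lborel)
      = real CARD('n) *\<^sub>R (inverse (e k) ^ CARD('n) *\<^sub>R (\<integral>z. indicator (ball 0 (e k)) z *\<^sub>R f (x - z) \<partial>lborel))" for k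
  proof -
    have "(\<Sum>i\<in>UNIV. \<integral>z. ?K k i z *\<^sub>R partial i f (x - z) \<partial>lborel)
        = (\<integral>z. (\<Sum>i\<in>UNIV. coulomb_deriv (e k) i z *\<^sub>R f (x - z)) \<partial>lborel)"
      unfolding parts using cd_int by simp
    also have "\<dots> = (\<integral>z. (real CARD('n) * inverse (e k) ^ CARD('n)) *\<^sub>R (indicator (ball 0 (e k)) z *\<^sub>R f (x - z)) \<partial>lborel)"
      by (simp add: sum_coulomb_deriv[OF e(1)] flip: scaleR_sum_left)
    finally show ?thesis by (simp only: integral_scaleR_right) simp
  qed
  have "(\<lambda>k. \<Sum>i\<in>UNIV. \<integral>z. ?K k i z *\<^sub>R partial i f (x - z) \<partial>lborel)
      \<longlonglongrightarrow> (\<Sum>i\<in>UNIV. \<integral>z. coulomb_kernel i z *\<^sub>R partial i f (x - z) \<partial>lborel)"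
  proof (intro tendsto_sum integral_dominated_convergence)
    fix i
    show "integrable lborel (\<lambda>z. norm (coulomb_kernel i z *\<^sub>R partial i f (x - z)))"
      by (intro integrable_norm convolution_integrable[OF ker] test_fun_partial f)
    show "AE z in lborel. (\<lambda>k. ?K k i z *\<^sub>R partial i f (x - z)) \<longlonglongrightarrow> coulomb_kernel i z *\<^sub>R partial i f (x - z)"
      using AE_lborel_singleton[of "0::real^'n"]
    proof eventually_elim
      case (elim z)
      show ?case
        by (rule tendsto_eventually, rule eventually_mono[OF eventually_regularization_outside[OF e(3) elim]])
          (simp add: max_def coulomb_kernel_def)
    qed
    show "AE z in lborel. norm (?K k i z *\<^sub>R partial i f (x - z)) \<le> norm (coulomb_kernel i z *\<^sub>R partial i f (x - z))" for k
      using AE_lborel_singleton[of "0::real^'n"]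
    proof eventually_elim
      case (elim z)
      have "inverse (max (norm z) (e k)) ^ CARD('n) \<le> inverse (norm z) ^ CARD('n)"
        using elim by (intro power_mono le_imp_inverse_le) (auto simp: le_max_iff_disj)
      moreover have "0 \<le> inverse (max (norm z) (e k)) ^ CARD('n)"
        by (simp add: le_max_iff_disj)
      ultimately show ?case
        unfolding coulomb_kernel_def norm_scaleR abs_mult by (intro mult_mono) auto
    qed
  qed measurable
  then have lim: "(\<lambda>k. real CARD('n) *\<^sub>R (inverse (e k) ^ CARD('n) *\<^sub>R (\<integral>z. indicator (ball 0 (e k)) z *\<^sub>R f (x - z) \<partial>lborel)))
      \<longlonglongrightarrow> (\<Sum>i\<in>UNIV. \<integral>z. coulomb_kernel i z *\<^sub>R partial i f (x - z) \<partial>lborel)"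
    by (simp only: avg)
  have "(\<lambda>k. inverse (e k) ^ CARD('n) *\<^sub>R (\<integral>z. indicator (ball 0 (e k)) z *\<^sub>R f (x - z) \<partial>lborel)) \<longlonglongrightarrow> ?w *\<^sub>R f x"
  proof (rule LIMSEQ_I)
    fix r :: real assume "r > 0"
    have w: "?w > 0" by (rule unit_ball_volume_pos)
    define d where "d = r / (2 * ?w)"
    have d: "d > 0" using \<open>r > 0\<close> w by (simp add: d_def)
    then obtain s where s: "s > 0" "\<And>y. dist y x < s \<Longrightarrow> dist (f y) (f x) < d"
      using test_fun_uniformly_continuous[OF f] unfolding uniformly_continuous_on_def by auto
    obtain N where N: "\<And>k. k \<ge> N \<Longrightarrow> e k < s"
      using order_tendstoD(2)[OF e(3) s(1)] by (auto simp: eventually_sequentially)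
    have "norm (inverse (e k) ^ CARD('n) *\<^sub>R (\<integral>z. indicator (ball 0 (e k)) z *\<^sub>R f (x - z) \<partial>lborel) - ?w *\<^sub>R f x) < r"
      if "k \<ge> N" for k
    proof -
      have "norm (f (x - z) - f x) \<le> d" if "norm z < e k" for z
        using s(2)[of "x - z"] N[OF \<open>k \<ge> N\<close>] that by (simp add: dist_norm)
      from norm_ball_average_le[OF f e(1) this]
      have "norm (inverse (e k) ^ CARD('n) *\<^sub>R (\<integral>z. indicator (ball 0 (e k)) z *\<^sub>R f (x - z) \<partial>lborel) - ?w *\<^sub>R f x) \<le> d * ?w"
        by simp
      also have "\<dots> < r" using \<open>r > 0\<close> w by (simp add: d_def)
      finally show ?thesis .
    qed
    then show "\<exists>N. \<forall>k\<ge>N. norm (inverse (e k) ^ CARD('n) *\<^sub>R (\<integral>z. indicator (ball 0 (e k)) z *\<^sub>R f (x - z) \<partial>lborel) - ?w *\<^sub>R f x) < r"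
      by blast
  qed
  from tendsto_scaleR[OF tendsto_const this] have "(\<lambda>k. real CARD('n) *\<^sub>R (inverse (e k) ^ CARD('n) *\<^sub>R
      (\<integral>z. indicator (ball 0 (e k)) z *\<^sub>R f (x - z) \<partial>lborel))) \<longlonglongrightarrow> real CARD('n) *\<^sub>R (?w *\<^sub>R f x)" .
  from LIMSEQ_unique[OF lim this] show ?thesis by simp
qed

section \<open>The Newtonian potential\<close>

definition newton_potential ::
    "(real^'n::finite \<Rightarrow> 'b::{banach, second_countable_topology}) \<Rightarrow> real^'n \<Rightarrow> 'b" where
  "newton_potential f x = (\<integral>y. fundamental_solution x y *\<^sub>R f y \<partial>lborel)"

context
  assumes n: "CARD('n::finite) \<ge> 2"
begin

lemma integrable_newton_potential:
  fixes f :: "real^'n \<Rightarrow> 'b::{banach, second_countable_topology}"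
  assumes "test_fun f"
  shows "integrable lborel (\<lambda>y. fundamental_solution x y *\<^sub>R f y)"
  unfolding fundamental_solution_eq[OF n]
  by (rule convolution_commute_integrable[OF locally_integrable_radial_potential[OF n] assms])

lemma newton_potential_convolution:
  fixes f :: "real^'n \<Rightarrow> 'b::{banach, second_countable_topology}"
  assumes "test_fun f"
  shows "newton_potential f x = (\<integral>z. radial_potential TYPE('n) (norm z) *\<^sub>R f (x - z) \<partial>lborel)"
  unfolding newton_potential_def fundamental_solution_eq[OF n]
  by (rule convolution_commute[OF locally_integrable_radial_potential[OF n] assms])

lemma newton_potential_bounded_linear:
  fixes f :: "real^'n \<Rightarrow> 'b::{banach, second_countable_topology}"
    and L :: "'b \<Rightarrow> 'c::{banach, second_countable_topology}"
  assumes "bounded_linear L" "test_fun f"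
  shows "newton_potential (\<lambda>y. L (f y)) x = L (newton_potential f x)"
  unfolding newton_potential_def
  by (subst integral_bounded_linear[OF assms(1) integrable_newton_potential[OF assms(2)], symmetric])
    (simp add: linear_scale[OF bounded_linear.linear[OF assms(1)]])

lemma newton_potential_sum:
  fixes f :: "'i \<Rightarrow> real^'n \<Rightarrow> 'b::{banach, second_countable_topology}"
  assumes "\<And>i. i \<in> I \<Longrightarrow> test_fun (f i)"
  shows "newton_potential (\<lambda>y. \<Sum>i\<in>I. f i y) x = (\<Sum>i\<in>I. newton_potential (f i) x)"
  unfolding newton_potential_def scaleR_sum_right
  by (rule Bochner_Integration.integral_sum) (rule integrable_newton_potential[OF assms])

lemma newton_potential_diff:
  fixes f g :: "real^'n \<Rightarrow> 'b::{banach, second_countable_topology}"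
  assumes "test_fun f" "test_fun g"
  shows "newton_potential (\<lambda>y. f y - g y) x = newton_potential f x - newton_potential g x"
  unfolding newton_potential_def scaleR_diff_right
  by (rule Bochner_Integration.integral_diff) (rule integrable_newton_potential, fact)+

text \<open>In the form \<open>\<integral> \<Gamma>(z) f(x - z) dz\<close> the linearization error of the potential is the integral of
  \<open>\<Gamma>\<close> against that of \<open>f\<close>. The latter is uniformly small and, for \<open>y\<close> close to \<open>x\<close>, supported in a
  fixed ball, over which \<open>\<Gamma>\<close> is integrable.\<close>
lemma newton_potential_has_derivative:
  fixes f :: "real^'n \<Rightarrow> 'b::{banach, second_countable_topology}"
  assumes f: "test_fun f"
  shows "(newton_potential f has_derivative
    (\<lambda>h. \<Sum>i\<in>UNIV. h $ i *\<^sub>R newton_potential (partial i f) x)) (at x)"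
  unfolding has_derivative_at_alt
proof (intro conjI allI impI)
  show "bounded_linear (\<lambda>h. \<Sum>i\<in>UNIV. h $ i *\<^sub>R newton_potential (partial i f) x)"
    by (intro bounded_linear_sum bounded_linear_scaleR_const bounded_linear_vec_nth)
next
  fix r :: real assume "r > 0"
  let ?p = "\<lambda>z :: real^'n. radial_potential TYPE('n) (norm z)"
  note pot = locally_integrable_radial_potential[OF n]
  note f' = test_fun_partial[OF f]
  obtain R where R: "R > 0" "\<And>x. norm x > R \<Longrightarrow> f x = 0"
    using test_fun_bounded_support[OF f] by blast
  \<comment> \<open>For \<open>norm (y - x) \<le> 1\<close>, both \<open>f (x - z)\<close> and \<open>f (y - z)\<close> vanish when \<open>norm z > S\<close>.\<close>
  define S where "S = R + norm x + 1"
  define M where "M = (\<integral>z. norm (indicator (cball 0 S) z *\<^sub>R ?p z) \<partial>lborel)"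
  have Mi: "integrable lborel (\<lambda>z. norm (indicator (cball 0 S) z *\<^sub>R ?p z))"
    using pot unfolding locally_integrable_def set_integrable_def by (intro integrable_norm) blast
  have M: "M \<ge> 0" unfolding M_def by (rule Bochner_Integration.integral_nonneg) simp
  \<comment> \<open>The added 1 covers the case \<open>M = 0\<close>.\<close>
  define e where "e = r / (M + 1)"
  have e: "e > 0" "M * e \<le> r" using \<open>r > 0\<close> M by (auto simp: e_def field_simps)
  obtain d where d: "d > 0" "\<And>x h. norm h < d \<Longrightarrow>
      norm (f (x + h) - f x - (\<Sum>i\<in>UNIV. h $ i *\<^sub>R partial i f x)) \<le> e * norm h"
    using test_fun_uniform_linearization[OF f e(1)] by blast
  have "norm (newton_potential f y - newton_potential f x
      - (\<Sum>i\<in>UNIV. (y - x) $ i *\<^sub>R newton_potential (partial i f) x)) \<le> r * norm (y - x)"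
    if y: "norm (y - x) < min d 1" for y
  proof -
    define h where "h = y - x"
    let ?F = "\<lambda>z. f (y - z) - f (x - z) - (\<Sum>i\<in>UNIV. h $ i *\<^sub>R partial i f (x - z))"
    have ints: "integrable lborel (\<lambda>z. ?p z *\<^sub>R f (y - z))" "integrable lborel (\<lambda>z. ?p z *\<^sub>R f (x - z))"
        "integrable lborel (\<lambda>z. h $ i *\<^sub>R (?p z *\<^sub>R partial i f (x - z)))" for i
      by (intro integrable_scaleR_right convolution_integrable[OF pot] f f')+
    have expand: "?p z *\<^sub>R ?F z = ?p z *\<^sub>R f (y - z) - ?p z *\<^sub>R f (x - z)
        - (\<Sum>i\<in>UNIV. h $ i *\<^sub>R (?p z *\<^sub>R partial i f (x - z)))" for z
      by (simp add: scaleR_diff_right scaleR_sum_right mult.commute)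
    have "newton_potential f y - newton_potential f x - (\<Sum>i\<in>UNIV. h $ i *\<^sub>R newton_potential (partial i f) x)
        = (\<integral>z. ?p z *\<^sub>R ?F z \<partial>lborel)"
      unfolding expand
      by (simp only: newton_potential_convolution f f' Bochner_Integration.integral_diff ints
          Bochner_Integration.integrable_diff Bochner_Integration.integrable_sum
          Bochner_Integration.integral_sum integral_scaleR_right)
    also have "norm \<dots> \<le> (\<integral>z. (e * norm h) * norm (indicator (cball 0 S) z *\<^sub>R ?p z) \<partial>lborel)"
    proof (rule Bochner_Integration.integral_norm_bound_integral)
      show "integrable lborel (\<lambda>z. ?p z *\<^sub>R ?F z)"
        unfolding expand
        by (intro Bochner_Integration.integrable_diff Bochner_Integration.integrable_sum ints)
      show "integrable lborel (\<lambda>z. (e * norm h) * norm (indicator (cball 0 S) z *\<^sub>R ?p z))"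
        by (rule integrable_mult_right[OF Mi])
      fix z :: "real^'n"
      show "norm (?p z *\<^sub>R ?F z) \<le> (e * norm h) * norm (indicator (cball 0 S) z *\<^sub>R ?p z)"
      proof (cases "norm z \<le> S")
        case True
        have "norm (?F z) \<le> e * norm h"
          using d(2)[of h "x - z"] y by (simp add: h_def algebra_simps)
        then have "\<bar>?p z\<bar> * norm (?F z) \<le> \<bar>?p z\<bar> * (e * norm h)"
          by (rule mult_left_mono) simp
        then show ?thesis using True by (simp add: mult.commute)
      next
        case False
        have "norm z \<le> norm (y - z) + norm y" "norm z \<le> norm (x - z) + norm x" "norm y \<le> norm x + norm (y - x)"
          by norm+
        then have "norm (y - z) > R" "norm (x - z) > R"
          using False y norm_ge_zero[of x] unfolding S_def by linarith+
        then have "?F z = 0" using R(2) partial_eq_0_outside[of R f, OF R(2)] by simp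
        then show ?thesis using False by simp
      qed
    qed
    also have "\<dots> = (e * norm h) * M" unfolding M_def by (rule integral_mult_right_zero)
    also have "\<dots> \<le> r * norm h" using mult_right_mono[OF e(2) norm_ge_zero[of h]] by (simp add: mult_ac)
    finally show ?thesis unfolding h_def .
  qed
  then show "\<exists>d>0. \<forall>y. norm (y - x) < d \<longrightarrow> norm (newton_potential f y - newton_potential f x
      - (\<Sum>i\<in>UNIV. (y - x) $ i *\<^sub>R newton_potential (partial i f) x)) \<le> r * norm (y - x)"
    using d(1) by (intro exI[of _ "min d 1"]) auto
qed

lemma newton_potential_differentiable:
  fixes f :: "real^'n \<Rightarrow> 'b::{banach, second_countable_topology}"
  shows "test_fun f \<Longrightarrow> newton_potential f differentiable (at x)"
  using newton_potential_has_derivative differentiableI by blast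

lemma partial_newton_potential:
  fixes f :: "real^'n \<Rightarrow> 'b::{banach, second_countable_topology}"
  assumes "test_fun f"
  shows "partial i (newton_potential f) x = newton_potential (partial i f) x"
  by (rule partial_eqI[OF newton_potential_has_derivative[OF assms]])

text \<open>One derivative is moved onto the kernel; the other completes the divergence against the Coulomb
  field.\<close>
lemma newton_potential_laplacian:
  fixes f :: "real^'n \<Rightarrow> 'b::{banach, second_countable_topology}"
  assumes f: "test_fun f"
  shows "(\<Sum>i\<in>UNIV. newton_potential (partial i (partial i f)) x) = f x"
proof -
  have "(\<Sum>i\<in>UNIV. newton_potential (partial i (partial i f)) x) =
      (1 / (real CARD('n) * unit_ball_volume TYPE('n))) *\<^sub>R
        (\<Sum>i\<in>UNIV. \<integral>z. coulomb_kernel i z *\<^sub>R partial i f (x - z) \<partial>lborel)"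
    by (simp add: newton_potential_convolution convolution_radial_potential_partial[OF n] f
        test_fun_partial scaleR_sum_right)
  also have "\<dots> = f x"
    unfolding sum_convolution_coulomb_partial[OF n f]
    using unit_ball_volume_pos[where 'n = 'n] by simp
  finally show ?thesis .
qed

text \<open>With \<open>L\<^sub>i t = t e\<^sub>i\<close> the operator \<open>\<Sum>\<^sub>i L\<^sub>i \<partial>\<^sub>i\<close> is the gradient, and with \<open>L\<^sub>i = M\<^sub>n(e\<^sub>i)\<^sup>T\<close> it is
  \<open>M\<^sub>n(\<nabla>)\<^sup>T\<close>; the two integral representations of the theorem are these two cases.\<close>
lemma
  fixes f :: "real^'n \<Rightarrow> 'b::{banach, second_countable_topology}"
    and L :: "'n \<Rightarrow> 'b \<Rightarrow> 'c::{banach, second_countable_topology}"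
  assumes f: "test_fun f" and L: "\<And>i. bounded_linear (L i)"
  shows integrable_coulomb_operator:
      "integrable lborel (\<lambda>y. \<Sum>i\<in>UNIV. coulomb_kernel i (x - y) *\<^sub>R L i (f y))"
    and first_order_operator_newton_potential:
      "(\<Sum>i\<in>UNIV. L i (partial i (newton_potential f) x)) = (1 / (real CARD('n) * unit_ball_volume TYPE('n))) *\<^sub>R
        (\<integral>y. (\<Sum>i\<in>UNIV. coulomb_kernel i (x - y) *\<^sub>R L i (f y)) \<partial>lborel)"
proof -
  note ker = locally_integrable_coulomb_kernel[OF n]
  have Lf: "test_fun (\<lambda>y. L i (f y))" for i by (rule test_fun_bounded_linear[OF L f])
  have int: "integrable lborel (\<lambda>y. coulomb_kernel i (x - y) *\<^sub>R L i (f y))" for i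
    by (rule convolution_commute_integrable[OF ker Lf])
  then show "integrable lborel (\<lambda>y. \<Sum>i\<in>UNIV. coulomb_kernel i (x - y) *\<^sub>R L i (f y))"
    by (intro Bochner_Integration.integrable_sum)
  have "L i (partial i (newton_potential f) x) = (1 / (real CARD('n) * unit_ball_volume TYPE('n))) *\<^sub>R
      (\<integral>y. coulomb_kernel i (x - y) *\<^sub>R L i (f y) \<partial>lborel)" for i
  proof -
    have "f differentiable (at y)" for y
      using f by (simp add: test_fun_def C_infinity_differentiable)
    then have "partial i (\<lambda>y. L i (f y)) = (\<lambda>y. L i (partial i f y))"
      by (intro ext partial_bounded_linear L)
    then have "L i (partial i (newton_potential f) x) = newton_potential (partial i (\<lambda>y. L i (f y))) x"
      by (simp add: partial_newton_potential f newton_potential_bounded_linear[OF L test_fun_partial[OF f]])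
    also have "\<dots> = (1 / (real CARD('n) * unit_ball_volume TYPE('n))) *\<^sub>R
        (\<integral>z. coulomb_kernel i z *\<^sub>R L i (f (x - z)) \<partial>lborel)"
      by (simp only: newton_potential_convolution test_fun_partial Lf convolution_radial_potential_partial[OF n])
    also have "(\<integral>z. coulomb_kernel i z *\<^sub>R L i (f (x - z)) \<partial>lborel) = (\<integral>y. coulomb_kernel i (x - y) *\<^sub>R L i (f y) \<partial>lborel)"
      by (rule convolution_commute[OF ker Lf, symmetric])
    finally show ?thesis .
  qed
  then show "(\<Sum>i\<in>UNIV. L i (partial i (newton_potential f) x)) = (1 / (real CARD('n) * unit_ball_volume TYPE('n))) *\<^sub>R
        (\<integral>y. (\<Sum>i\<in>UNIV. coulomb_kernel i (x - y) *\<^sub>R L i (f y)) \<partial>lborel)"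
    by (simp only: Bochner_Integration.integral_sum int scaleR_sum_right)
qed

end

section \<open>The decomposition\<close>

lemma test_fun_divergence:
  assumes "test_fun a"
  shows "test_fun (divergence a)"
  unfolding divergence_def[abs_def]
  by (intro test_fun_sum test_fun_partial test_fun_nth assms finite)

lemma test_fun_gen_curl:
  fixes a :: "real^'n::{finite,linorder} \<Rightarrow> real^'n::{finite,linorder}"
  assumes a: "test_fun a"
  shows "test_fun (gen_curl a :: real^'n::{finite,linorder} \<Rightarrow> real^'m::{finite,linorder})"
proof -
  have "gen_curl a = (\<lambda>x. \<Sum>l\<in>UNIV. (cross_matrix (axis l 1) :: (_, 'm) vec) *v partial l a x)"
    using a by (intro ext gen_curl_eq) (simp add: test_fun_def C_infinity_differentiable)
  then show ?thesis
    by (simp only:) (intro test_fun_sum finite test_fun_bounded_linear[OF matrix_vector_mul_bounded_linear]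
        test_fun_partial a)
qed

lemma transpose_cross_matrix_expand:
  fixes b :: "real^'n::{finite,linorder}" and c :: "real^'m::{finite,linorder}"
  assumes "CARD('m) = CARD('n) * (CARD('n) - 1) div 2"
  shows "transpose (cross_matrix b) *v c = (\<Sum>l\<in>UNIV. b $ l *\<^sub>R (transpose (cross_matrix (axis l 1)) *v c))"
proof -
  have "(\<Sum>l\<in>UNIV. b $ l * (\<Sum>i\<in>A. axis l 1 $ i * g i)) = (\<Sum>i\<in>A. b $ i * g i)"
    for A :: "'n set" and g :: "'n \<Rightarrow> real"
  proof -
    have "(\<Sum>l\<in>UNIV. b $ l * (\<Sum>i\<in>A. axis l 1 $ i * g i)) = (\<Sum>i\<in>A. \<Sum>l\<in>UNIV. b $ l * (axis l 1 $ i * g i))"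
      unfolding sum_distrib_left by (rule sum.swap)
    also have "\<dots> = (\<Sum>i\<in>A. b $ i * g i)"
      by (simp add: axis_def if_distrib[of "\<lambda>t. t * _"] if_distrib[of "\<lambda>t. _ * t"] cong: if_cong)
    finally show ?thesis .
  qed
  then show ?thesis
    by (simp add: vec_eq_iff transpose_cross_matrix_mult_nth[OF assms] right_diff_distrib sum_subtractf
        del: transpose_matrix_vector)
qed

lemma norm_powi_coulomb_kernel:
  fixes z :: "real^'n::finite"
  shows "norm z powi (- int CARD('n)) * z $ i = coulomb_kernel i z"
  by (simp add: coulomb_kernel_def power_int_minus power_inverse)

lemma partial_diff:
  assumes "f differentiable (at x)" "g differentiable (at x)"
  shows "partial i (\<lambda>z. f z - g z) x = partial i f x - partial i g x"
proof -
  have "((\<lambda>z. f z - g z) has_derivative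
      (\<lambda>h. frechet_derivative f (at x) h - frechet_derivative g (at x) h)) (at x)"
    by (intro has_derivative_diff) (use assms in \<open>simp_all flip: frechet_derivative_works\<close>)
  from frechet_derivative_at[OF this] show ?thesis by (simp add: partial_def fun_eq_iff)
qed

text \<open>The potential of \<open>curl a\<close> is the curl of the potential of \<open>a\<close>. The index \<open>i\<close> of the outer derivative
  is free, since \<open>M\<^sub>n(\<nabla>)\<^sup>T\<close> differentiates the \<open>(j, k)\<close> entry with respect to either index.\<close>
lemma curl_potential_component:
  fixes a :: "real^'n::{finite,linorder} \<Rightarrow> real^'n::{finite,linorder}" and x :: "real^'n::{finite,linorder}"
  assumes n: "CARD('n) \<ge> 2"
    and m: "CARD('m::{finite,linorder}) = CARD('n) * (CARD('n) - 1) div 2"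
    and a: "test_fun a" and "j < k"
  shows "partial i (\<lambda>z. newton_potential (gen_curl a :: _ \<Rightarrow> (real, 'm) vec) z $ pair_pos j k) x =
    newton_potential (partial i (partial j (\<lambda>z. a z $ k))) x - newton_potential (partial i (partial k (\<lambda>z. a z $ j))) x"
proof -
  have an: "test_fun (partial l (\<lambda>z. a z $ q))" for l q by (intro test_fun_partial test_fun_nth a)
  have "newton_potential (gen_curl a :: _ \<Rightarrow> (real, 'm) vec) z $ pair_pos j k
      = newton_potential (partial j (\<lambda>z. a z $ k)) z - newton_potential (partial k (\<lambda>z. a z $ j)) z" for z
  proof -
    have "newton_potential (gen_curl a :: _ \<Rightarrow> (real, 'm) vec) z $ pair_pos j k
        = newton_potential (\<lambda>y. (gen_curl a :: _ \<Rightarrow> (real, 'm) vec) y $ pair_pos j k) z"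
      by (rule newton_potential_bounded_linear[OF n bounded_linear_vec_nth test_fun_gen_curl[OF a], symmetric])
    also have "(\<lambda>y. (gen_curl a :: _ \<Rightarrow> (real, 'm) vec) y $ pair_pos j k) =
        (\<lambda>y. partial j (\<lambda>z. a z $ k) y - partial k (\<lambda>z. a z $ j) y)"
      by (simp add: gen_curl_def pair_at_pair_pos[OF m \<open>j < k\<close>])
    also have "newton_potential \<dots> z = newton_potential (partial j (\<lambda>z. a z $ k)) z
        - newton_potential (partial k (\<lambda>z. a z $ j)) z"
      by (rule newton_potential_diff[OF n an an])
    finally show ?thesis .
  qed
  then show ?thesis
    by (simp add: partial_diff newton_potential_differentiable[OF n an] partial_newton_potential[OF n an])
qed

text \<open>The identity \<open>M\<^sub>n(\<nabla>)\<^sup>T M\<^sub>n(\<nabla>) = \<Delta> - \<nabla> div\<close>, applied under the potential. The terms with \<open>i < k\<close> and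
  those with \<open>i > k\<close> have the same form \<open>Q i\<close>, and \<open>Q k = 0\<close> fills the gap in the sum.\<close>
lemma newton_potential_curl_curl:
  fixes a :: "real^'n::{finite,linorder} \<Rightarrow> real^'n::{finite,linorder}" and x :: "real^'n::{finite,linorder}"
  assumes n: "CARD('n) \<ge> 2"
    and m: "CARD('m::{finite,linorder}) = CARD('n) * (CARD('n) - 1) div 2"
    and a: "test_fun a"
  shows "cross_matrix_nabla_transpose (newton_potential (gen_curl a :: _ \<Rightarrow> (real, 'm) vec)) x $ k
    = a x $ k - newton_potential (partial k (divergence a)) x"
proof -
  have ai: "test_fun (\<lambda>z. a z $ i)" for i by (rule test_fun_nth[OF a])
  define Q where "Q i = newton_potential (partial i (partial i (\<lambda>z. a z $ k))) x
    - newton_potential (partial k (partial i (\<lambda>z. a z $ i))) x" for i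
  have comm: "partial i (partial j f) = partial j (partial i f)" if "test_fun f" for i j and f :: "(real, 'n) vec \<Rightarrow> real"
    by (rule ext) (rule partial_commute[OF that])
  have less: "partial i (\<lambda>z. newton_potential (gen_curl a :: _ \<Rightarrow> (real, 'm) vec) z $ pair_pos i k) x = Q i" if "i < k" for i
    unfolding curl_potential_component[OF n m a that] Q_def comm[OF ai, of i k] ..
  have greater: "partial j (\<lambda>z. newton_potential (gen_curl a :: _ \<Rightarrow> (real, 'm) vec) z $ pair_pos k j) x = - Q j" if "k < j" for j
    unfolding curl_potential_component[OF n m a that] Q_def comm[OF ai, of j k] by simp
  have "cross_matrix_nabla_transpose (newton_potential (gen_curl a :: _ \<Rightarrow> (real, 'm) vec)) x $ k
      = (\<Sum>i | i < k. Q i) + (\<Sum>j | k < j. Q j)"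
    by (simp add: cross_matrix_nabla_transpose_def less greater sum_negf)
  also have "\<dots> = (\<Sum>i\<in>{i. i < k} \<union> {j. k < j}. Q i)"
    by (rule sum.union_disjoint[symmetric]) auto
  also have "\<dots> = (\<Sum>i\<in>UNIV. Q i)"
    by (rule sum.mono_neutral_left) (auto simp: Q_def not_less intro: order.antisym)
  also have "\<dots> = a x $ k - (\<Sum>i\<in>UNIV. newton_potential (partial k (partial i (\<lambda>z. a z $ i))) x)"
    unfolding Q_def sum_subtractf newton_potential_laplacian[OF n ai] ..
  also have "(\<Sum>i\<in>UNIV. newton_potential (partial k (partial i (\<lambda>z. a z $ i))) x)
      = newton_potential (partial k (divergence a)) x"
  proof -
    have "partial k (divergence a) = (\<lambda>x. \<Sum>i\<in>UNIV. partial k (partial i (\<lambda>z. a z $ i)) x)"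
      unfolding divergence_def[abs_def] by (intro ext partial_sum finite test_fun_partial ai)
    then show ?thesis
      by (simp add: newton_potential_sum[OF n] test_fun_partial ai)
  qed
  finally show ?thesis .
qed

theorem mainTheorem5:
  fixes a :: "real^'n::{finite,linorder} \<Rightarrow> real^'n::{finite,linorder}"
  assumes n: "CARD('n) \<ge> 2"
    and m: "CARD('m::{finite,linorder}) = CARD('n) * (CARD('n) - 1) div 2"
    and smooth: "C_infinity a"
    and support: "compactly_supported a"
  defines "\<omega> \<equiv> unit_ball_volume TYPE('n)"
    and "G \<equiv> (fundamental_solution ::
        real^'n::{finite,linorder} \<Rightarrow> real^'n::{finite,linorder} \<Rightarrow> real)"
    and "curl \<equiv> (gen_curl :: (real^'n::{finite,linorder} \<Rightarrow> real^'n::{finite,linorder}) \<Rightarrow>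
        real^'n::{finite,linorder} \<Rightarrow> real^'m::{finite,linorder})"
  shows "\<exists>a_div a_curl.
    (\<forall>x. a x = a_div x + a_curl x)
    \<and> (\<forall>x. a_div differentiable (at x) \<and> divergence a_div x = 0)
    \<and> gradient_field a_curl
    \<and> (\<forall>x. a_curl differentiable (at x) \<and> curl a_curl x = 0)
    \<and> (\<forall>x.
        integrable lborel (\<lambda>y. G x y * divergence a y)
      \<and> GDERIV (\<lambda>z. \<integral>y. G z y * divergence a y \<partial>lborel) x :> a_curl x
      \<and> integrable lborel
          (\<lambda>y. (norm (x - y) powi (- int CARD('n)) * divergence a y) *\<^sub>R (x - y))
      \<and> a_curl x = (1 / (real CARD('n) * \<omega>)) *\<^sub>R
          (\<integral>y. (norm (x - y) powi (- int CARD('n)) * divergence a y) *\<^sub>R (x - y) \<partial>lborel))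
    \<and> (\<forall>x.
        integrable lborel (\<lambda>y. G x y *\<^sub>R curl a y)
      \<and> (\<lambda>z. \<integral>y. G z y *\<^sub>R curl a y \<partial>lborel) differentiable (at x)
      \<and> a_div x = cross_matrix_nabla_transpose (\<lambda>z. \<integral>y. G z y *\<^sub>R curl a y \<partial>lborel) x
      \<and> integrable lborel
          (\<lambda>y. transpose (cross_matrix (x - y)) *v
                 (norm (x - y) powi (- int CARD('n)) *\<^sub>R curl a y))
      \<and> a_div x = (1 / (real CARD('n) * \<omega>)) *\<^sub>R
          (\<integral>y. transpose (cross_matrix (x - y)) *v
                 (norm (x - y) powi (- int CARD('n)) *\<^sub>R curl a y) \<partial>lborel))"
proof -
  have a: "test_fun a" using smooth support by (rule test_funI)
  have ai: "test_fun (\<lambda>z. a z $ i)" for i by (rule test_fun_nth[OF a])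
  define g where "g = divergence a"
  have g: "test_fun g" unfolding g_def by (rule test_fun_divergence[OF a])
  note g' = test_fun_partial[OF g]
  define c where "c = curl a"
  have c: "test_fun c" unfolding c_def curl_def by (rule test_fun_gen_curl[OF a])
  have pot_g: "(\<lambda>z. \<integral>y. G z y * divergence a y \<partial>lborel) = newton_potential g"
    by (simp add: newton_potential_def[abs_def] G_def g_def)
  have pot_c: "(\<lambda>z. \<integral>y. G z y *\<^sub>R curl a y \<partial>lborel) = newton_potential c"
    by (simp add: newton_potential_def[abs_def] G_def c_def)
  define a_curl where "a_curl x = (\<Sum>k\<in>UNIV. newton_potential (partial k g) x *\<^sub>R axis k (1::real))" for x
  define a_div where "a_div x = a x - a_curl x" for x
  have a_curl_nth: "a_curl x $ k = newton_potential (partial k g) x" for x k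
    by (simp add: a_curl_def axis_def if_distrib[of "\<lambda>t. _ * t"] cong: if_cong)
  have a_curl_diff: "a_curl differentiable (at x)" for x
    unfolding a_curl_def[abs_def]
    by (intro differentiable_sum differentiable_scaleR newton_potential_differentiable[OF n g'] finite differentiable_const ballI)
  have a_diff: "a differentiable (at x)" for x using smooth by (rule C_infinity_differentiable)
  have a_div_diff: "a_div differentiable (at x)" for x
    unfolding a_div_def[abs_def] by (intro differentiable_diff a_diff a_curl_diff)
  have "divergence a_div x = 0" for x
  proof -
    have "partial i (\<lambda>z. a_div z $ i) x = partial i (\<lambda>z. a z $ i) x - newton_potential (partial i (partial i g)) x" for i
      unfolding a_div_def vector_minus_component a_curl_nth
      using C_infinity_differentiable[of "\<lambda>z. a z $ i" x] ai[of i]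
      by (simp add: partial_diff newton_potential_differentiable[OF n g'] partial_newton_potential[OF n g'] test_fun_def)
    then have "divergence a_div x = g x - (\<Sum>i\<in>UNIV. newton_potential (partial i (partial i g)) x)"
      by (simp add: divergence_def g_def sum_subtractf)
    then show ?thesis by (simp add: newton_potential_laplacian[OF n g])
  qed
  moreover have gderiv: "GDERIV (newton_potential g) x :> a_curl x" for x
    using newton_potential_has_derivative[OF n g, of x]
    by (simp add: gderiv_def inner_vec_def a_curl_nth)
  then have "gradient_field a_curl" unfolding gradient_field_def by blast
  moreover have "curl a_curl x = 0" for x
  proof -
    have "partial i (\<lambda>z. a_curl z $ j) x = partial j (\<lambda>z. a_curl z $ i) x" for i j
    proof -
      have "partial i (partial j g) = partial j (partial i g)"
        by (rule ext) (rule partial_commute[OF g])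
      then show ?thesis by (simp add: a_curl_nth partial_newton_potential[OF n g'])
    qed
    then show ?thesis by (simp add: curl_def gen_curl_def vec_eq_iff split: prod.split)
  qed
  moreover have "integrable lborel (\<lambda>y. G x y * divergence a y)" for x
    using integrable_newton_potential[OF n g, of x] by (simp add: G_def g_def)
  moreover have "integrable lborel (\<lambda>y. (norm (x - y) powi (- int CARD('n)) * divergence a y) *\<^sub>R (x - y))"
    and "a_curl x = (1 / (real CARD('n) * \<omega>)) *\<^sub>R
          (\<integral>y. (norm (x - y) powi (- int CARD('n)) * divergence a y) *\<^sub>R (x - y) \<partial>lborel)" for x
  proof -
    have L: "bounded_linear (\<lambda>t. t *\<^sub>R (axis i 1 :: (real, 'n) vec))" for i
      by (rule bounded_linear_scaleR_left)
    have eq: "(norm (x - y) powi (- int CARD('n)) * divergence a y) *\<^sub>R (x - y)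
        = (\<Sum>i\<in>UNIV. coulomb_kernel i (x - y) *\<^sub>R (g y *\<^sub>R axis i 1))" for y
      by (simp add: vec_eq_iff axis_def if_distrib[of "\<lambda>t. _ * t"] if_distrib[of "\<lambda>t. t * _"] g_def norm_powi_coulomb_kernel[symmetric] mult_ac cong: if_cong)
    show "integrable lborel (\<lambda>y. (norm (x - y) powi (- int CARD('n)) * divergence a y) *\<^sub>R (x - y))"
      unfolding eq by (rule integrable_coulomb_operator[OF n g L])
    show "a_curl x = (1 / (real CARD('n) * \<omega>)) *\<^sub>R
          (\<integral>y. (norm (x - y) powi (- int CARD('n)) * divergence a y) *\<^sub>R (x - y) \<partial>lborel)"
      unfolding eq \<omega>_def
      using first_order_operator_newton_potential[OF n g L, of x]
      by (simp only: partial_newton_potential[OF n g] a_curl_def)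
  qed
  moreover have "integrable lborel (\<lambda>y. G x y *\<^sub>R curl a y)" for x
    using integrable_newton_potential[OF n c, of x] by (simp add: G_def c_def)
  moreover have "newton_potential c differentiable (at x)" for x
    by (rule newton_potential_differentiable[OF n c])
  moreover have a_div_eq: "a_div x = cross_matrix_nabla_transpose (newton_potential c) x" for x
    unfolding vec_eq_iff c_def curl_def
    by (simp add: newton_potential_curl_curl[OF n m a] a_div_def a_curl_nth g_def)
  moreover have "integrable lborel (\<lambda>y. transpose (cross_matrix (x - y)) *v (norm (x - y) powi (- int CARD('n)) *\<^sub>R curl a y))"
    and "a_div x = (1 / (real CARD('n) * \<omega>)) *\<^sub>R
          (\<integral>y. transpose (cross_matrix (x - y)) *v (norm (x - y) powi (- int CARD('n)) *\<^sub>R curl a y) \<partial>lborel)" for x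
  proof -
    have L: "bounded_linear (\<lambda>w. transpose (cross_matrix (axis i 1) :: (_, 'm) vec) *v w)" for i :: 'n
      by (rule matrix_vector_mul_bounded_linear)
    have eq: "transpose (cross_matrix (x - y)) *v (norm (x - y) powi (- int CARD('n)) *\<^sub>R curl a y)
        = (\<Sum>i\<in>UNIV. coulomb_kernel i (x - y) *\<^sub>R (transpose (cross_matrix (axis i 1)) *v c y))" for y
      unfolding transpose_cross_matrix_expand[OF m, of "x - y"] c_def
      by (simp add: matrix_vector_mult_scaleR norm_powi_coulomb_kernel[symmetric] mult.commute
          del: transpose_matrix_vector)
    show "integrable lborel (\<lambda>y. transpose (cross_matrix (x - y)) *v (norm (x - y) powi (- int CARD('n)) *\<^sub>R curl a y))"
      unfolding eq by (rule integrable_coulomb_operator[OF n c L])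
    show "a_div x = (1 / (real CARD('n) * \<omega>)) *\<^sub>R
          (\<integral>y. transpose (cross_matrix (x - y)) *v (norm (x - y) powi (- int CARD('n)) *\<^sub>R curl a y) \<partial>lborel)"
      unfolding eq \<omega>_def a_div_eq cross_matrix_nabla_transpose_eq[OF m newton_potential_differentiable[OF n c]]
      by (rule first_order_operator_newton_potential[OF n c L])
  qed
  moreover have "a x = a_div x + a_curl x" for x by (simp add: a_div_def)
  ultimately show ?thesis
    unfolding pot_g pot_c using a_div_diff a_curl_diff gderiv
    by (intro exI[of _ a_div] exI[of _ a_curl] conjI allI) simp_all
qed

end
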